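(* Let $X$ be a topological lop whose underlying topological space is regular, non-metrizable, sequential, and of countable $\mathrm{cs}^*$-character. Then $X$ contains a sublop $U$ which is clopen (closed and open) in $X$ and which is an $sk_\omega$-space in the subspace topology.
   Context: All topological spaces are assumed to be regular (including the $T_1$ axiom). A topological lop is a topological space $X$ endowed with a continuous binary operation $X\times X\to X$, $(x,y)\mapsto xy$, which has a two-sided unit $e$ (so $xe=x=ex$ for all $x\in X$) and for which the map $X\times X\to X\times X$, $(x,y)\mapsto(x,xy)$, is a homeomorphism. The operation need not be associative. For $a,b\in X$, $a^{-1}b$ denotes the unique $x\in X$ with $ax=b$. A sublop of $X$ is a nonempty subset $A\subset X$ such that $ab\in A$ and $a^{-1}b\in A$ for all $a,b\in A$. A family $\mathcal N$ of subsets of $X$ is a $\mathrm{cs}^*$-network at a point $x\in X$ if for each neighborhood $O_x$ of $x$ and each sequence $(x_n)_{n\in\omega}$ in $X$ converging to $x$ there is $N\in\mathcal N$ such that $x\in N\subset O_x$ and $x_n\in N$ for infinitely many $n$. The space $X$ has countable $\mathrm{cs}^*$-character if at each point $x\in X$ it has a countable $\mathrm{cs}^*$-network. A space $X$ is sequential if for each non-closed subset $A\subset X$ there is a sequence in $A$ that converges in $X$ to a point $x\notin A$. A space $X$ is an $sk_\omega$-space if there is a countable cover $\mathcal K$ of $X$ by compact metrizable subspaces such that a set $A\subset X$ is closed in $X$ if and only if $A\cap K$ is closed in $K$ for every $K\in\mathcal K$. *)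

theory Defs
  imports "HOL-Analysis.Analysis"
begin

text \<open>
  A space is a value of type \<open>'a topology\<close> with point set \<open>topspace X\<close>. The operation of a lop is
  a function on the whole type, but only its values on \<open>topspace X\<close> matter. The library's
  \<open>regular_space\<close> does not include the $T_1$ axiom, which has to be required separately.
\<close>

definition topological_lop :: "'a topology \<Rightarrow> ('a \<Rightarrow> 'a \<Rightarrow> 'a) \<Rightarrow> bool" where
  "topological_lop X mul \<longleftrightarrow>
     continuous_map (prod_topology X X) X (\<lambda>(x, y). mul x y) \<and>
     (\<exists>e\<in>topspace X. \<forall>x\<in>topspace X. mul x e = x \<and> mul e x = x) \<and>
     homeomorphic_map (prod_topology X X) (prod_topology X X) (\<lambda>(x, y). (x, mul x y))"

definition left_div :: "'a topology \<Rightarrow> ('a \<Rightarrow> 'a \<Rightarrow> 'a) \<Rightarrow> 'a \<Rightarrow> 'a \<Rightarrow> 'a" where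
  "left_div X mul a b = (THE x. x \<in> topspace X \<and> mul a x = b)"

lemma topological_lop_ex1_left_div:
  assumes "topological_lop X mul" and "a \<in> topspace X" and "b \<in> topspace X"
  shows "\<exists>!x. x \<in> topspace X \<and> mul a x = b"
proof -
  let ?f = "\<lambda>(x, y). (x, mul x y)"
  let ?S = "topspace X \<times> topspace X"
  have h: "homeomorphic_map (prod_topology X X) (prod_topology X X) ?f"
    using assms(1) by (simp add: topological_lop_def)
  have im: "?f ` ?S = ?S"
    using homeomorphic_imp_surjective_map[OF h] by simp
  have inj: "inj_on ?f ?S"
    using homeomorphic_imp_injective_map[OF h] by simp
  have "(a, b) \<in> ?f ` ?S"
    using assms(2,3) im by blast
  then obtain x where x: "x \<in> topspace X" "mul a x = b"
    by auto
  have "y = x" if "y \<in> topspace X" "mul a y = b" for y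
    using inj_onD[OF inj, of "(a, y)" "(a, x)"] x that assms(2) by simp
  with x show ?thesis
    by blast
qed

definition sublop :: "'a topology \<Rightarrow> ('a \<Rightarrow> 'a \<Rightarrow> 'a) \<Rightarrow> 'a set \<Rightarrow> bool" where
  "sublop X mul A \<longleftrightarrow>
     A \<noteq> {} \<and> A \<subseteq> topspace X \<and>
     (\<forall>a\<in>A. \<forall>b\<in>A. mul a b \<in> A \<and> left_div X mul a b \<in> A)"

text \<open>
  A library limit \<open>limitin X s x sequentially\<close> constrains only a tail of \<open>s\<close>, so sequences in the
  space are additionally required to satisfy \<open>range s \<subseteq> topspace X\<close>.
\<close>

definition cs_star_network_at :: "'a topology \<Rightarrow> 'a \<Rightarrow> 'a set set \<Rightarrow> bool" where
  "cs_star_network_at X x \<N> \<longleftrightarrow>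
     \<N> \<subseteq> Pow (topspace X) \<and>
     (\<forall>W s. openin X W \<and> x \<in> W \<and> range s \<subseteq> topspace X \<and> limitin X s x sequentially \<longrightarrow>
        (\<exists>N\<in>\<N>. x \<in> N \<and> N \<subseteq> W \<and> infinite {n::nat. s n \<in> N}))"

definition countable_cs_star_character :: "'a topology \<Rightarrow> bool" where
  "countable_cs_star_character X \<longleftrightarrow>
     (\<forall>x\<in>topspace X. \<exists>\<N>. countable \<N> \<and> cs_star_network_at X x \<N>)"

definition sequential_space :: "'a topology \<Rightarrow> bool" where
  "sequential_space X \<longleftrightarrow>
     (\<forall>A. A \<subseteq> topspace X \<and> \<not> closedin X A \<longrightarrow>
        (\<exists>s x. range s \<subseteq> A \<and> x \<notin> A \<and> limitin X s x sequentially))"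

definition sk_omega_space :: "'a topology \<Rightarrow> bool" where
  "sk_omega_space X \<longleftrightarrow>
     (\<exists>\<K>. countable \<K> \<and> \<Union>\<K> = topspace X \<and>
        (\<forall>K\<in>\<K>. compactin X K \<and> metrizable_space (subtopology X K)) \<and>
        (\<forall>A. A \<subseteq> topspace X \<longrightarrow>
           (closedin X A \<longleftrightarrow> (\<forall>K\<in>\<K>. closedin (subtopology X K) (A \<inter> K)))))"

end

theory Submission
  imports Defs
begin

text \<open>
  Let \<open>\<N>\<close> be a countable network at the unit \<open>e\<close> for convergent sequences, consisting of closed sets.
  If every double sequence with \<open>x k n \<longlonglongrightarrow> e\<close> for each \<open>k\<close> had a diagonal converging to \<open>e\<close>, then
  \<open>X\<close> would be first countable at \<open>e\<close>, and hence metrizable by a Frink-type argument. So some double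
  sequence \<open>x\<close> has no such diagonal. Suppose closed sets \<open>P k\<close> shrink to \<open>e\<close> and each contains a
  sequence \<open>y k n\<close> without convergent subsequence; then for suitable \<open>m\<close> the set of the points
  \<open>y k n \<cdot> x k (m k n)\<close> other than \<open>e\<close> is sequentially closed with \<open>e\<close> in its closure, a
  contradiction. Therefore every sequence converging to \<open>e\<close> is almost contained in one of countably
  many sequentially compact sets. The sublop generated by them is an increasing union of sequentially
  compact sets, which are metrizable because closures of countable sets have countable networks, and
  it is open because it is sequentially open.
\<close>

section \<open>Metrization by symmetric neighbourhood assignments\<close>

text \<open>The obstacle is that only left division is at hand: products cannot be rebracketed, and
  right translations need not be homeomorphisms. Three choices come from this. The sets of
  \<open>y\<close> with \<open>ldiv x y\<close> close to the unit need not give a uniformity, since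
  the size of a neighbourhood whose square is small depends on \<open>x\<close>; hence a metrization
  criterion whose indices vary with the point. In the product of \<open>y k n\<close> and
  \<open>x k (m k n)\<close> the factor from \<open>P k\<close> stands on the left: it tends to
  \<open>e\<close> as \<open>k\<close> grows, and dividing by it isolates the other factor. For
  fixed \<open>k\<close>, however, multiplying on the right could destroy the divergence of
  \<open>y k\<close>, and \<open>m\<close> is chosen to prevent that. Finally, sequential
  compactness is carried along instead of compactness, because it passes to products and quotients
  by choosing subsequences. Metrization is needed at both ends, so it is proved for a set
  \<open>K\<close> whose quotients lie in a set \<open>C\<close> that is strongly Frechet at
  \<open>e\<close>: \<open>C\<close> is the whole space in the indirect argument, and the next stage
  of the generated sublop at the end.\<close>

lemma chain_sum_bound:
  fixes f :: "'a \<Rightarrow> 'a \<Rightarrow> real"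
  assumes nonneg: "\<And>x y. f x y \<ge> 0"
    and refl: "\<And>x. x \<in> S \<Longrightarrow> f x x = 0"
    and three: "\<And>a b c d \<epsilon>. \<lbrakk>a \<in> S; b \<in> S; c \<in> S; d \<in> S; \<epsilon> > 0; f a b \<le> \<epsilon>; f b c \<le> \<epsilon>; f c d \<le> \<epsilon>\<rbrakk>
                 \<Longrightarrow> f a d \<le> 2 * \<epsilon>"
  shows "\<lbrakk>\<And>i. c i \<in> S; (\<Sum>i<l. f (c i) (c (Suc i))) \<le> s; s > 0\<rbrakk> \<Longrightarrow> f (c 0) (c l) \<le> 2 * s"
proof (induction l arbitrary: c s rule: less_induct)
  case (less l)
  show ?case
  proof (cases "l = 0")
    case True
    with less.prems refl show ?thesis by simp
  next
    case False
    let ?g = "\<lambda>i. f (c i) (c (Suc i))"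
    let ?P = "\<lambda>j. j < l \<and> (\<Sum>i<j. ?g i) \<le> s / 2"
    \<comment> \<open>Frink's cut: \<open>j\<close> is the last index at which at most half of the
      total has been used. The links before \<open>j\<close> and those after \<open>Suc j\<close>
      each sum to at most \<open>s / 2\<close>, so induction bounds both ends by \<open>s\<close>;
      the single link between them is at most \<open>s\<close> as well, and \<open>three\<close>
      yields \<open>2 * s\<close>.\<close>
    define j where "j = (GREATEST j. ?P j)"
    have "?P 0" using False less.prems by simp
    then have j: "?P j"
      unfolding j_def by (rule GreatestI_nat[where b = l]) simp
    have "(\<Sum>i<k + m. ?g i) = (\<Sum>i<k. ?g i) + (\<Sum>i<m. ?g (i + k))" for k m
      by (induction m) (auto simp: add_ac)
    then have split: "(\<Sum>i<l. ?g i) = (\<Sum>i<k. ?g i) + (\<Sum>i<l - k. ?g (i + k))" if "k \<le> l" for k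
      using that by (metis le_add_diff_inverse)
    have pre: "f (c 0) (c j) \<le> 2 * (s / 2)"
      using less.IH[of j c "s/2"] j less.prems by simp
    have mid: "f (c j) (c (Suc j)) \<le> s"
    proof -
      have "?g j \<le> (\<Sum>i<l. ?g i)"
        using j nonneg by (intro member_le_sum) auto
      then show ?thesis using less.prems by simp
    qed
    have post: "f (c (Suc j)) (c l) \<le> 2 * (s / 2)"
    proof (cases "Suc j = l")
      case True
      then show ?thesis using refl less.prems by simp
    next
      case False
      with j have sl: "Suc j < l" by simp
      have "\<not> ?P (Suc j)"
      proof
        assume "?P (Suc j)"
        then have "Suc j \<le> j"
          unfolding j_def by (intro Greatest_le_nat[where b = l]) auto
        then show False by simp
      qed
      with sl have gt: "(\<Sum>i<Suc j. ?g i) > s / 2" by simp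
      have "(\<Sum>i<l - Suc j. ?g (i + Suc j)) \<le> s / 2"
        using split[of "Suc j"] sl gt less.prems by simp
      then show ?thesis
        using less.IH[of "l - Suc j" "\<lambda>i. c (i + Suc j)" "s/2"] sl less.prems by simp
    qed
    show ?thesis
      using three[of "c 0" "c j" "c (Suc j)" "c l" s] pre mid post less.prems by simp
  qed
qed

text \<open>For symmetric nonnegative \<open>f\<close> the infimum of this set is the largest
  pseudometric on \<open>S\<close> below \<open>f\<close>. A chain is an infinite sequence of which
  only the entries up to \<open>l\<close> count; \<open>l = 0\<close> is allowed and gives the sum
  0.\<close>

definition chain_sums :: "'a set \<Rightarrow> ('a \<Rightarrow> 'a \<Rightarrow> real) \<Rightarrow> 'a \<Rightarrow> 'a \<Rightarrow> real set" where
  "chain_sums S f x y =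
     {(\<Sum>i<l. f (c i) (c (Suc i))) | c l. c 0 = x \<and> c l = y \<and> (\<forall>i. c i \<in> S)}"

lemma chain_sums_single:
  assumes "x \<in> S" "y \<in> S"
  shows "f x y \<in> chain_sums S f x y"
  unfolding chain_sums_def
  using assms by (intro CollectI exI[of _ "\<lambda>i. if i = 0 then x else y"] exI[of _ 1]) auto

lemma chain_sums_trivial:
  assumes "x \<in> S"
  shows "0 \<in> chain_sums S f x x"
  unfolding chain_sums_def using assms by (intro CollectI exI[of _ "\<lambda>i. x"] exI[of _ 0]) auto

lemma chain_sums_reverse:
  assumes sym: "\<And>x y. f x y = f y x" and s: "s \<in> chain_sums S f x y"
  shows "s \<in> chain_sums S f y x"
proof -
  obtain c l where c: "c 0 = x" "c l = y" "\<forall>i. c i \<in> S" "s = (\<Sum>i<l. f (c i) (c (Suc i)))"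
    using s unfolding chain_sums_def by auto
  have "s = (\<Sum>i<l. f (c (l - Suc i)) (c (Suc (l - Suc i))))"
    unfolding c(4) by (rule sum.nat_diff_reindex[symmetric])
  also have "\<dots> = (\<Sum>i<l. f (c (l - i)) (c (l - Suc i)))"
    by (intro sum.cong) (auto simp: sym Suc_diff_Suc)
  finally show ?thesis
    unfolding chain_sums_def using c by (intro CollectI exI[of _ "\<lambda>i. c (l - i)"] exI[of _ l]) auto
qed

lemma chain_sums_concat:
  assumes "s \<in> chain_sums S f x y" "t \<in> chain_sums S f y z"
  shows "s + t \<in> chain_sums S f x z"
proof -
  obtain c l where c: "c 0 = x" "c l = y" "\<forall>i. c i \<in> S" "s = (\<Sum>i<l. f (c i) (c (Suc i)))"
    using assms(1) unfolding chain_sums_def by auto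
  obtain c' l' where c': "c' 0 = y" "c' l' = z" "\<forall>i. c' i \<in> S" "t = (\<Sum>i<l'. f (c' i) (c' (Suc i)))"
    using assms(2) unfolding chain_sums_def by auto
  define b where "b = (\<lambda>i. if i < l then c i else c' (i - l))"
  have b1: "b i = c i" if "i \<le> l" for i
    using that c c' by (cases "i = l") (auto simp: b_def)
  have b2: "b (l + i) = c' i" for i by (simp add: b_def)
  have "(\<Sum>i<l + l'. f (b i) (b (Suc i))) =
        (\<Sum>i<l. f (b i) (b (Suc i))) + (\<Sum>i<l'. f (b (l + i)) (b (Suc (l + i))))"
    by (induction l') auto
  also have "(\<Sum>i<l. f (b i) (b (Suc i))) = s"
    unfolding c(4) by (intro sum.cong) (auto simp: b1)
  also have "(\<Sum>i<l'. f (b (l + i)) (b (Suc (l + i)))) = t"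
    unfolding c'(4) by (simp add: b2 flip: add_Suc_right)
  finally show ?thesis
    unfolding chain_sums_def using b1[of 0] b2[of l'] c c'
    by (intro CollectI exI[of _ b] exI[of _ "l + l'"]) (auto simp: b_def)
qed

text \<open>The classical metrization of a countable uniform base. With \<open>f x y\<close> equal
  to 1/2 to the power of the first \<open>n\<close> at which \<open>(x, y)\<close> leaves
  \<open>E n\<close>, \<open>cube\<close> becomes the hypothesis \<open>three\<close> of the chain
  lemma. The infimum \<open>d\<close> over chains then satisfies
  \<open>d \<le> f \<le> 2 * d\<close>, so its balls and the \<open>E n\<close> give the same
  topology; the T1 axiom separates points.\<close>

lemma metrizable_space_entourages:
  assumes t1: "t1_space T" and S: "topspace T = S"
    and refl: "\<And>n x. x \<in> S \<Longrightarrow> (x, x) \<in> E n"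
    and sym: "\<And>n x y. (x, y) \<in> E n \<Longrightarrow> (y, x) \<in> E n"
    and cube: "\<And>n a b c d. \<lbrakk>a \<in> S; b \<in> S; c \<in> S; d \<in> S;
                 (a, b) \<in> E (Suc n); (b, c) \<in> E (Suc n); (c, d) \<in> E (Suc n)\<rbrakk> \<Longrightarrow> (a, d) \<in> E n"
    and dec: "\<And>n. E (Suc n) \<subseteq> E n"
    and nbhd: "\<And>n x. x \<in> S \<Longrightarrow> \<exists>G. openin T G \<and> x \<in> G \<and> (\<forall>y\<in>G. (x, y) \<in> E n)"
    and base: "\<And>G x. \<lbrakk>openin T G; x \<in> G\<rbrakk> \<Longrightarrow> \<exists>n. \<forall>y\<in>S. (x, y) \<in> E n \<longrightarrow> y \<in> G"
  shows "metrizable_space T"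
proof -
  define f :: "'a \<Rightarrow> 'a \<Rightarrow> real" where
    "f = (\<lambda>x y. if \<forall>n. (x, y) \<in> E n then 0 else (1/2) ^ (LEAST n. (x, y) \<notin> E n))"
  have mono: "E n \<subseteq> E m" if "m \<le> n" for m n
    using lift_Suc_antimono_le[of E, OF dec that] .
  have f_less: "f x y < (1/2) ^ n \<longleftrightarrow> (x, y) \<in> E n" for x y n
  proof
    assume "(x, y) \<in> E n"
    show "f x y < (1/2) ^ n"
    proof (cases "\<forall>n. (x, y) \<in> E n")
      case False
      define N where "N = (LEAST n. (x, y) \<notin> E n)"
      have "(x, y) \<notin> E N" unfolding N_def using False by (metis (mono_tags) LeastI_ex)
      with \<open>(x, y) \<in> E n\<close> mono have "n < N" by (meson not_le subsetD)
      then have "(1/2::real) ^ N < (1/2) ^ n" by (intro power_strict_decreasing) auto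
      then show ?thesis using False by (simp add: f_def N_def)
    qed (simp add: f_def)
  next
    assume less: "f x y < (1/2) ^ n"
    show "(x, y) \<in> E n"
    proof (rule ccontr)
      assume n: "(x, y) \<notin> E n"
      then have "(LEAST n. (x, y) \<notin> E n) \<le> n" by (rule Least_le)
      then have "(1/2::real) ^ n \<le> (1/2) ^ (LEAST n. (x, y) \<notin> E n)"
        by (intro power_decreasing) auto
      also have "\<dots> = f x y" using n by (auto simp: f_def)
      finally show False using less by simp
    qed
  qed
  have f0: "f x y \<ge> 0" for x y by (simp add: f_def)
  have frefl: "f x x = 0" if "x \<in> S" for x using that refl by (simp add: f_def)
  have fsym: "f x y = f y x" for x y
  proof -
    have "(x, y) \<in> E n \<longleftrightarrow> (y, x) \<in> E n" for n using sym by blast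
    then show ?thesis by (simp add: f_def)
  qed
  have f3: "f a d \<le> 2 * \<epsilon>"
    if S: "a \<in> S" "b \<in> S" "c \<in> S" "d \<in> S" and \<epsilon>: "\<epsilon> > 0" "f a b \<le> \<epsilon>" "f b c \<le> \<epsilon>" "f c d \<le> \<epsilon>"
    for a b c d \<epsilon>
  proof (rule ccontr)
    assume gt: "\<not> f a d \<le> 2 * \<epsilon>"
    then obtain N where N: "f a d = (1/2) ^ N"
      using \<epsilon> by (auto simp: f_def split: if_splits)
    then have "\<epsilon> < (1/2) ^ Suc N" using gt by simp
    then have "(a, b) \<in> E (Suc N)" "(b, c) \<in> E (Suc N)" "(c, d) \<in> E (Suc N)"
      using \<epsilon> by (auto simp flip: f_less simp del: power_Suc)
    then have "(a, d) \<in> E N" using cube S by blast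
    then show False using N f_less[of a d N] by simp
  qed
  \<comment> \<open>The value 0 outside \<open>S\<close> keeps \<open>d\<close> nonnegative and
    symmetric on the whole type, as \<open>Metric_space\<close> demands.\<close>
  define d where "d = (\<lambda>x y. if x \<in> S \<and> y \<in> S then Inf (chain_sums S f x y) else 0)"
  have ge0: "s \<ge> 0" if "s \<in> chain_sums S f x y" for s x y
    using that f0 by (auto simp: chain_sums_def intro!: sum_nonneg)
  have bdd: "bdd_below (chain_sums S f x y)" for x y
    using ge0 by (meson bdd_belowI)
  have d_le: "d x y \<le> s" if "s \<in> chain_sums S f x y" "x \<in> S" "y \<in> S" for x y s
    using that bdd by (auto simp: d_def intro: cInf_lower)
  have le_d: "r \<le> d x y" if "x \<in> S" "y \<in> S" "\<And>s. s \<in> chain_sums S f x y \<Longrightarrow> r \<le> s" for x y r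
    using that chain_sums_single[of x S y f] by (auto simp: d_def intro!: cInf_greatest)
  have d_gt: "\<exists>s\<in>chain_sums S f x y. s < r" if "x \<in> S" "y \<in> S" "d x y < r" for x y r
    using le_d[OF that(1,2), of r] that(3) by force
  have f_le: "f x y \<le> 2 * r" if xy: "x \<in> S" "y \<in> S" "d x y < r" for x y r
  proof -
    obtain s where s: "s \<in> chain_sums S f x y" "s < r" using d_gt[OF xy] by blast
    then obtain c l where c: "c 0 = x" "c l = y" "\<forall>i. c i \<in> S" "s = (\<Sum>i<l. f (c i) (c (Suc i)))"
      unfolding chain_sums_def by auto
    have "r > 0" using s ge0 by force
    then have "f (c 0) (c l) \<le> 2 * r"
      using c s by (intro chain_sum_bound[of f S]) (auto intro: f0 frefl f3)
    then show ?thesis using c by simp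
  qed
  \<comment> \<open>The exponent \<open>n + 2\<close> pays one halving for the factor 2 in
    \<open>f_le\<close> and one for strictness.\<close>
  have small: "(x, y) \<in> E n" if "x \<in> S" "y \<in> S" "d x y < (1/2) ^ (n + 2)" for x y n
  proof -
    have "f x y \<le> (1/2) ^ n / 2" using f_le[OF that] by simp
    also have "\<dots> < (1/2) ^ n" by simp
    finally show ?thesis by (simp only: f_less)
  qed
  have M: "Metric_space S d"
  proof
    show "0 \<le> d x y" for x y
      using le_d[of x y 0] ge0 by (auto simp: d_def)
    show "d x y = d y x" for x y
    proof -
      have "chain_sums S f x y = chain_sums S f y x"
        using chain_sums_reverse[of f] fsym by blast
      then show ?thesis by (simp add: d_def)
    qed
    show "d x z \<le> d x y + d y z" if xyz: "x \<in> S" "y \<in> S" "z \<in> S" for x y z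
    proof (rule field_le_epsilon)
      fix \<epsilon> :: real assume "0 < \<epsilon>"
      obtain s where s: "s \<in> chain_sums S f x y" "s < d x y + \<epsilon> / 2"
        using d_gt[of x y "d x y + \<epsilon>/2"] xyz \<open>0 < \<epsilon>\<close> by auto
      obtain t where t: "t \<in> chain_sums S f y z" "t < d y z + \<epsilon> / 2"
        using d_gt[of y z "d y z + \<epsilon>/2"] xyz \<open>0 < \<epsilon>\<close> by auto
      have "d x z \<le> s + t" by (intro d_le chain_sums_concat[OF s(1) t(1)] xyz)
      with s t show "d x z \<le> d x y + d y z + \<epsilon>" by simp
    qed
    show "d x y = 0 \<longleftrightarrow> x = y" if xy: "x \<in> S" "y \<in> S" for x y
    proof
      assume d0: "d x y = 0"
      show "x = y"
      proof (rule ccontr)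
        assume "x \<noteq> y"
        then obtain G where "openin T G" "x \<in> G" "y \<notin> G"
          using t1 xy S unfolding t1_space_def by metis
        then obtain n where "(x, y) \<notin> E n" using base xy by blast
        then show False using small[of x y n] d0 xy by simp
      qed
    next
      assume "x = y"
      then show "d x y = 0"
        using d_le[OF chain_sums_trivial[of x S f]] le_d[of x x 0] ge0 xy by force
    qed
  qed
  let ?B = "Metric_space.mball S d" and ?T = "Metric_space.mtopology S d"
  note in_ball = Metric_space.in_mball[OF M]
  have "openin T G \<longleftrightarrow> openin ?T G" for G
  proof
    assume G: "openin T G"
    have "\<exists>r>0. ?B x r \<subseteq> G" if x: "x \<in> G" for x
    proof -
      obtain n where "\<forall>y\<in>S. (x, y) \<in> E n \<longrightarrow> y \<in> G" using base[OF G x] by blast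
      then have "?B x ((1/2) ^ (n+2)) \<subseteq> G" using small by (auto simp: in_ball)
      then show ?thesis by (intro exI[of _ "(1/2) ^ (n+2)"]) auto
    qed
    then show "openin ?T G"
      using openin_subset[OF G] S by (auto simp: Metric_space.openin_mtopology[OF M])
  next
    assume "openin ?T G"
    then have G: "G \<subseteq> S" "\<And>x. x \<in> G \<Longrightarrow> \<exists>r>0. ?B x r \<subseteq> G"
      by (auto simp: Metric_space.openin_mtopology[OF M])
    have "\<exists>H. openin T H \<and> x \<in> H \<and> H \<subseteq> G" if x: "x \<in> G" for x
    proof -
      obtain r where r: "r > 0" "?B x r \<subseteq> G" using G x by blast
      obtain n where n: "(1/2) ^ n < r" using real_arch_pow_inv[OF r(1), of "1/2"] by auto
      obtain H where H: "openin T H" "x \<in> H" "\<forall>y\<in>H. (x, y) \<in> E n"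
        using nbhd[of x n] x G by blast
      have "y \<in> G" if y: "y \<in> H" for y
      proof -
        have S': "x \<in> S" "y \<in> S" using x G y openin_subset[OF H(1)] S by auto
        have "d x y \<le> f x y" by (intro d_le chain_sums_single S')
        also have "\<dots> < (1/2) ^ n" using f_less H y by blast
        finally show ?thesis using r n S' by (auto simp: in_ball)
      qed
      then show ?thesis using H by blast
    qed
    then show "openin T G" by (subst openin_subopen) blast
  qed
  then have "T = ?T" by (simp add: topology_eq)
  then show ?thesis using Metric_space.metrizable_space_mtopology[OF M] by simp
qed

text \<open>
  The local square condition becomes uniform when the index of the neighbourhood is allowed to
  depend on the point: the neighbourhoods \<open>V (k n x) x\<close> form covers in which the union of any two
  intersecting members of the \<open>n+1\<close>-st cover lies in a member of the \<open>n\<close>-th.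
\<close>

theorem metrizable_space_symmetric_neighbourhoods:
  fixes V :: "nat \<Rightarrow> 'a \<Rightarrow> 'a set"
  assumes t1: "t1_space T" and S: "topspace T = S"
    and sub: "\<And>n x. x \<in> S \<Longrightarrow> V n x \<subseteq> S"
    and nbhd: "\<And>n x. x \<in> S \<Longrightarrow> \<exists>G. openin T G \<and> x \<in> G \<and> G \<subseteq> V n x"
    and sym: "\<And>n x y. \<lbrakk>x \<in> S; y \<in> V n x\<rbrakk> \<Longrightarrow> x \<in> V n y"
    and dec: "\<And>n x. x \<in> S \<Longrightarrow> V (Suc n) x \<subseteq> V n x"
    and base: "\<And>G x. \<lbrakk>openin T G; x \<in> G\<rbrakk> \<Longrightarrow> \<exists>n. V n x \<subseteq> G"
    and square: "\<And>n x. x \<in> S \<Longrightarrow> \<exists>m. \<forall>y\<in>V m x. V m y \<subseteq> V n x"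
  shows "metrizable_space T"
proof -
  have mem: "x \<in> V n x" if "x \<in> S" for n x using nbhd[OF that] by blast
  have mono: "V n x \<subseteq> V m x" if "m \<le> n" "x \<in> S" for m n x
    using lift_Suc_antimono_le[of "\<lambda>n. V n x", OF dec[OF that(2)] that(1)] .
  have "\<exists>m. \<forall>y\<in>S. V m x \<inter> V m y \<noteq> {} \<longrightarrow> V m y \<subseteq> V n x" if x: "x \<in> S" for n x
  proof -
    \<comment> \<open>For a common point \<open>z\<close>, symmetry turns \<open>z\<close> in the
      set of \<open>y\<close> into \<open>y\<close> in the set of \<open>z\<close>. So
      \<open>m2\<close> leads from \<open>x\<close> through \<open>z\<close> to \<open>y\<close>,
      and \<open>m1\<close> then takes in the whole neighbourhood of \<open>y\<close>.\<close>
    obtain m1 where m1: "\<forall>y\<in>V m1 x. V m1 y \<subseteq> V n x" using square x by blast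
    obtain m2 where m2: "\<forall>y\<in>V m2 x. V m2 y \<subseteq> V m1 x" using square x by blast
    have "V (max m1 m2) y \<subseteq> V n x" if y: "y \<in> S" and z: "z \<in> V (max m1 m2) x" "z \<in> V (max m1 m2) y" for y z
    proof -
      have zS: "z \<in> S" using z x sub by blast
      have "z \<in> V m2 x" "y \<in> V m2 z"
        using z sym[OF y z(2)] mono[of m2 "max m1 m2"] x zS by auto
      then have "y \<in> V m1 x" using m2 by blast
      then show ?thesis using m1 mono[of m1 "max m1 m2" y] y by auto
    qed
    then show ?thesis by blast
  qed
  then have "\<exists>m. \<forall>n x. x \<in> S \<longrightarrow> (\<forall>y\<in>S. V (m n x) x \<inter> V (m n x) y \<noteq> {} \<longrightarrow> V (m n x) y \<subseteq> V n x)"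
    by (intro choice allI) blast
  then obtain m where m: "\<And>n x y. \<lbrakk>x \<in> S; y \<in> S; V (m n x) x \<inter> V (m n x) y \<noteq> {}\<rbrakk> \<Longrightarrow> V (m n x) y \<subseteq> V n x"
    by blast
  \<comment> \<open>\<open>m (r x) x\<close> absorbs intersecting neighbourhoods, \<open>r x\<close>
    keeps the sets decreasing, and \<open>Suc n\<close> makes the indices grow uniformly in the
    point, which \<open>base\<close> requires below.\<close>
  define k where "k = rec_nat (\<lambda>x. 0) (\<lambda>n r x. max (max (Suc n) (r x)) (m (r x) x))"
  have k_Suc: "k (Suc n) x = max (max (Suc n) (k n x)) (m (k n x) x)" for n x
    by (simp add: k_def)
  have k_ge: "n \<le> k n x" for n x by (cases n) (auto simp: k_Suc)
  define U where "U = (\<lambda>n x. V (k n x) x)"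
  have U_dec: "U (Suc n) x \<subseteq> U n x" if "x \<in> S" for n x
    unfolding U_def using that by (intro mono) (auto simp: k_Suc)
  \<comment> \<open>Of two intersecting members, the one with the smaller index absorbs the other:
    both indices at level \<open>Suc n\<close> are then at least \<open>m (k n x) x\<close>.\<close>
  have key: "U (Suc n) x \<union> U (Suc n) y \<subseteq> U n x"
    if xy: "x \<in> S" "y \<in> S" "U (Suc n) x \<inter> U (Suc n) y \<noteq> {}" "k (Suc n) x \<le> k (Suc n) y" for n x y
  proof -
    let ?m = "m (k n x) x"
    have "U (Suc n) y \<subseteq> V ?m y" "U (Suc n) x \<subseteq> V ?m x"
      unfolding U_def using xy by (intro mono; auto simp: k_Suc)+
    moreover from this have "V ?m y \<subseteq> V (k n x) x" using m[of x y "k n x"] xy by blast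
    ultimately show ?thesis using U_dec[of x n] xy by (auto simp: U_def)
  qed
  define E where "E = (\<lambda>n. \<Union>x\<in>S. U n x \<times> U n x)"
  have E_square: "(a, c) \<in> E n" if ab: "(a, b) \<in> E (Suc n)" "(b, c) \<in> E (Suc n)" for a b c n
  proof -
    obtain x where x: "x \<in> S" "a \<in> U (Suc n) x" "b \<in> U (Suc n) x" using ab by (auto simp: E_def)
    obtain y where y: "y \<in> S" "b \<in> U (Suc n) y" "c \<in> U (Suc n) y" using ab by (auto simp: E_def)
    show ?thesis
    proof (cases "k (Suc n) x \<le> k (Suc n) y")
      case True
      then show ?thesis using key[of x y n] x y by (auto simp: E_def)
    next
      case False
      then show ?thesis using key[of y x n] x y by (auto simp: E_def)
    qed
  qed
  have E_refl: "(x, x) \<in> E n" if "x \<in> S" for x n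
    using that mem by (auto simp: E_def U_def)
  have E_dec: "E (Suc n) \<subseteq> E n" for n
    using U_dec unfolding E_def by blast
  have E_mono: "E n \<subseteq> E m" if "m \<le> n" for m n
    using lift_Suc_antimono_le[of E, OF E_dec that] .
  show ?thesis
  \<comment> \<open>\<open>E_square\<close> composes two relations per level; composing three takes
    two levels, hence the index \<open>2 * n\<close>.\<close>
  proof (rule metrizable_space_entourages[OF t1 S, where E = "\<lambda>n. E (2 * n)"])
    show "(x, x) \<in> E (2 * n)" if "x \<in> S" for n x by (rule E_refl[OF that])
    show "(y, x) \<in> E (2 * n)" if "(x, y) \<in> E (2 * n)" for n x y using that by (auto simp: E_def)
    show "(a, d) \<in> E (2 * n)"
      if "a \<in> S" "b \<in> S" "c \<in> S" "d \<in> S"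
         "(a, b) \<in> E (2 * Suc n)" "(b, c) \<in> E (2 * Suc n)" "(c, d) \<in> E (2 * Suc n)" for n a b c d
    proof -
      have "(a, c) \<in> E (Suc (2 * n))" using E_square that by simp
      moreover have "(c, d) \<in> E (Suc (2 * n))" using E_dec that by auto
      ultimately show ?thesis by (rule E_square)
    qed
    show "E (2 * Suc n) \<subseteq> E (2 * n)" for n by (rule E_mono) simp
    show "\<exists>G. openin T G \<and> x \<in> G \<and> (\<forall>y\<in>G. (x, y) \<in> E (2 * n))" if x: "x \<in> S" for n x
    proof -
      obtain G where "openin T G" "x \<in> G" "G \<subseteq> U (2 * n) x"
        using nbhd[OF x] unfolding U_def by blast
      then show ?thesis using x unfolding E_def by blast
    qed
    show "\<exists>n. \<forall>y\<in>S. (x, y) \<in> E (2 * n) \<longrightarrow> y \<in> G" if G: "openin T G" "x \<in> G" for G x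
    proof -
      have x: "x \<in> S" using G openin_subset S by blast
      obtain p where p: "V p x \<subseteq> G" using base G by blast
      have "y \<in> G" if y: "(x, y) \<in> E (2 * m p x)" for y
      proof -
        let ?n = "2 * m p x"
        obtain z where z: "z \<in> S" "x \<in> U ?n z" "y \<in> U ?n z" using y by (auto simp: E_def)
        \<comment> \<open>The unknown centre \<open>z\<close> causes no harm because
          \<open>k_ge\<close> bounds its index from below independently of \<open>z\<close>.\<close>
        have "m p x \<le> k ?n z" using k_ge[of ?n z] by simp
        then have "U ?n z \<subseteq> V (m p x) z" unfolding U_def using z by (intro mono)
        moreover have "V (m p x) z \<subseteq> V p x"
          using m[of x z p] x z mem[OF x] calculation by blast
        ultimately show ?thesis using z p by blast
      qed
      then show ?thesis by blast
    qed
  qed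
qed

section \<open>Sequences in sequential lops\<close>

text \<open>The limit is required to lie in \<open>K\<close>, so such sets are closed under limits
  of sequences. Compactness is recovered from this notion once the set is known to be
  metrizable.\<close>

definition seq_compactin :: "'a topology \<Rightarrow> 'a set \<Rightarrow> bool" where
  "seq_compactin X K \<longleftrightarrow> K \<subseteq> topspace X \<and>
     (\<forall>s. range s \<subseteq> K \<longrightarrow>
        (\<exists>r x. strict_mono (r :: nat \<Rightarrow> nat) \<and> x \<in> K \<and> limitin X (s \<circ> r) x sequentially))"

definition has_convergent_subseq :: "'a topology \<Rightarrow> (nat \<Rightarrow> 'a) \<Rightarrow> bool" where
  "has_convergent_subseq X s \<longleftrightarrow>
     (\<exists>r x. strict_mono (r :: nat \<Rightarrow> nat) \<and> limitin X (s \<circ> r) x sequentially)"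

lemma limitin_eq_eventually:
  assumes "limitin X s x F" "\<forall>\<^sub>F n in F. s n = t n"
  shows "limitin X t x F"
  unfolding limitin_def
proof (intro conjI allI impI)
  show "x \<in> topspace X" using assms(1) by (rule limitin_topspace)
  fix U assume "openin X U \<and> x \<in> U"
  with assms(1) have "\<forall>\<^sub>F n in F. s n \<in> U" by (auto simp: limitin_def)
  with assms(2) show "\<forall>\<^sub>F n in F. t n \<in> U" by eventually_elim simp
qed

locale seq_lop =
  fixes X :: "'a topology" and mul :: "'a \<Rightarrow> 'a \<Rightarrow> 'a" and e :: 'a
  assumes lop: "topological_lop X mul"
    and unit_in [simp]: "e \<in> topspace X"
    and mul_unit [simp]: "x \<in> topspace X \<Longrightarrow> mul x e = x"
    and unit_mul [simp]: "x \<in> topspace X \<Longrightarrow> mul e x = x"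
    and regular: "regular_space X" and t1: "t1_space X"
    and sequential: "sequential_space X"
begin

abbreviation ldiv :: "'a \<Rightarrow> 'a \<Rightarrow> 'a" where "ldiv \<equiv> left_div X mul"

abbreviation conv :: "(nat \<Rightarrow> 'a) \<Rightarrow> 'a \<Rightarrow> bool" where
  "conv s x \<equiv> limitin X s x sequentially"

lemma Hausdorff: "Hausdorff_space X"
  using regular t1 by (simp add: regular_t1_imp_Hausdorff_space)

lemma continuous_mul: "continuous_map (prod_topology X X) X (\<lambda>(x, y). mul x y)"
  using lop by (simp add: topological_lop_def)

lemma mul_in [simp]: "\<lbrakk>x \<in> topspace X; y \<in> topspace X\<rbrakk> \<Longrightarrow> mul x y \<in> topspace X"
  using continuous_map_image_subset_topspace[OF continuous_mul] by auto

lemma ldiv: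
  assumes "a \<in> topspace X" "b \<in> topspace X"
  shows ldiv_in [simp]: "ldiv a b \<in> topspace X" and mul_ldiv [simp]: "mul a (ldiv a b) = b"
  unfolding left_div_def using theI'[OF topological_lop_ex1_left_div[OF lop assms]] by auto

lemma ldiv_eqI:
  assumes "a \<in> topspace X" "x \<in> topspace X" "mul a x = b"
  shows "ldiv a b = x"
proof -
  have b: "b \<in> topspace X" using assms mul_in by blast
  show ?thesis
    using topological_lop_ex1_left_div[OF lop assms(1) b] ldiv[OF assms(1) b] assms(2,3) by metis
qed

lemma ldiv_mul [simp]: "\<lbrakk>a \<in> topspace X; x \<in> topspace X\<rbrakk> \<Longrightarrow> ldiv a (mul a x) = x"
  by (rule ldiv_eqI) auto

lemma ldiv_self [simp]: "a \<in> topspace X \<Longrightarrow> ldiv a a = e"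
  by (rule ldiv_eqI) auto

lemma ldiv_unit [simp]: "a \<in> topspace X \<Longrightarrow> ldiv e a = a"
  by (rule ldiv_eqI) auto

text \<open>Left division is the second coordinate of the inverse of the homeomorphism sending
  \<open>(x, y)\<close> to \<open>(x, mul x y)\<close>.\<close>

lemma continuous_ldiv: "continuous_map (prod_topology X X) X (\<lambda>(x, y). ldiv x y)"
proof -
  let ?f = "\<lambda>(x, y). (x, mul x y)"
  have "homeomorphic_map (prod_topology X X) (prod_topology X X) ?f"
    using lop by (simp add: topological_lop_def)
  then obtain g where g: "homeomorphic_maps (prod_topology X X) (prod_topology X X) ?f g"
    unfolding homeomorphic_map_maps by blast
  have cont: "continuous_map (prod_topology X X) X (snd \<circ> g)"
    using g continuous_map_snd by (auto simp: homeomorphic_maps_def intro: continuous_map_compose)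
  have "(snd \<circ> g) p = (\<lambda>(x, y). ldiv x y) p" if p: "p \<in> topspace (prod_topology X X)" for p
  proof -
    obtain a b where ab: "p = (a, b)" "a \<in> topspace X" "b \<in> topspace X" using p by auto
    obtain c x where cx: "g p = (c, x)" by (cases "g p")
    have "?f (g p) = p" using g p by (auto simp: homeomorphic_maps_def)
    moreover have "g p \<in> topspace (prod_topology X X)"
      using g p unfolding homeomorphic_maps_def
      by (metis continuous_map_image_subset_topspace image_subset_iff)
    ultimately show ?thesis using ab cx by (auto intro!: ldiv_eqI[symmetric])
  qed
  then show ?thesis by (rule continuous_map_eq[OF cont])
qed

lemma conv_binary:
  assumes "continuous_map (prod_topology X X) X (\<lambda>(x, y). h x y)" "conv s x" "conv t y"
  shows "conv (\<lambda>n. h (s n) (t n)) (h x y)"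
proof -
  have "limitin (prod_topology X X) (\<lambda>n. (s n, t n)) (x, y) sequentially"
    using assms by (simp add: limitin_pairwise o_def)
  then show ?thesis
    using continuous_map_limit[OF assms(1)] by (fastforce simp: o_def)
qed

lemmas conv_mul = conv_binary[OF continuous_mul]
lemmas conv_ldiv = conv_binary[OF continuous_ldiv]

text \<open>This and the next lemma move convergence to the unit, where the network lives.
  \<open>ldiv (s n) x\<close> expresses the limit through the terms and serves to show that limits
  belong to a set; \<open>ldiv x (s n)\<close> expresses the terms through the limit and serves to
  capture tails.\<close>

lemma conv_ldiv_left:
  assumes "conv s x"
  shows "conv (\<lambda>n. ldiv (s n) x) e"
  using conv_ldiv[OF assms, of "\<lambda>n. x" x] limitin_topspace[OF assms] by simp

lemma conv_ldiv_right:
  assumes "conv s x"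
  shows "conv (\<lambda>n. ldiv x (s n)) e"
  using conv_ldiv[of "\<lambda>n. x" x, OF _ assms] limitin_topspace[OF assms] by simp

lemma conv_in_eventually: "conv s x \<Longrightarrow> \<forall>\<^sub>F n in sequentially. s n \<in> topspace X"
  using openin_topspace by (auto simp: limitin_def)

lemma conv_unique: "\<lbrakk>conv s x; conv s y\<rbrakk> \<Longrightarrow> x = y"
  using limitin_Hausdorff_unique[OF _ _ _ Hausdorff, of s x sequentially y] by simp

lemma open_binary:
  assumes "continuous_map (prod_topology X X) X (\<lambda>(x, y). h x y)" "openin X G"
    and "x \<in> topspace X" "y \<in> topspace X" "h x y \<in> G"
  obtains V W where "openin X V" "openin X W" "x \<in> V" "y \<in> W" "\<forall>v\<in>V. \<forall>w\<in>W. h v w \<in> G"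
proof -
  let ?H = "{p \<in> topspace (prod_topology X X). (\<lambda>(x, y). h x y) p \<in> G}"
  have "openin (prod_topology X X) ?H"
    using assms(1,2) by (rule openin_continuous_map_preimage)
  moreover have "(x, y) \<in> ?H" using assms by simp
  ultimately obtain V W where VW: "openin X V" "openin X W" "x \<in> V" "y \<in> W" "V \<times> W \<subseteq> ?H"
    using openin_prod_topology_alt[of X X ?H] by blast
  have "h v w \<in> G" if "v \<in> V" "w \<in> W" for v w
    using subsetD[OF VW(5), of "(v, w)"] that by simp
  then have "\<forall>v\<in>V. \<forall>w\<in>W. h v w \<in> G" by blast
  then show thesis using that VW(1-4) by metis
qed

lemmas open_ldiv = open_binary[OF continuous_ldiv]

lemma open_mul_unit:
  assumes G: "openin X G" "x \<in> G"
  obtains V W where "openin X V" "openin X W" "x \<in> V" "e \<in> W" "\<forall>v\<in>V. \<forall>w\<in>W. mul v w \<in> G"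
proof -
  have x: "x \<in> topspace X" using G openin_subset by blast
  have "mul x e \<in> G" using x G by simp
  from open_binary[OF continuous_mul G(1) x unit_in this] show thesis using that by metis
qed

lemma regularE:
  assumes "openin X G" "x \<in> G"
  obtains V where "openin X V" "x \<in> V" "X closure_of V \<subseteq> G"
proof -
  have "closedin X (topspace X - G)" "x \<in> topspace X - (topspace X - G)"
    using assms openin_subset by (auto simp: closedin_def Diff_Diff_Int inf.absorb2)
  then obtain V where V: "openin X V" "x \<in> V" "disjnt (topspace X - G) (X closure_of V)"
    using regular unfolding regular_space by metis
  then have "X closure_of V \<subseteq> G"
    using closure_of_subset_topspace[of X V] by (auto simp: disjnt_iff)
  then show thesis using that V(1,2) by metis
qed

lemma closedin_sequentially:
  assumes "A \<subseteq> topspace X" "\<And>s x. \<lbrakk>range s \<subseteq> A; conv s x\<rbrakk> \<Longrightarrow> x \<in> A"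
  shows "closedin X A"
proof (rule ccontr)
  assume "\<not> closedin X A"
  then obtain s x where "range s \<subseteq> A" "x \<notin> A" "conv s x"
    using sequential assms(1) unfolding sequential_space_def by metis
  then show False using assms(2) by blast
qed

lemma closedin_conv: "\<lbrakk>closedin X A; conv s x; range s \<subseteq> A\<rbrakk> \<Longrightarrow> x \<in> A"
  using limitin_closedin[of X s x sequentially A] by (auto simp: image_subset_iff)

lemma seq_compactin_closedin:
  assumes K: "seq_compactin X K"
  shows "closedin X K"
proof (rule closedin_sequentially)
  show "K \<subseteq> topspace X" using K by (simp add: seq_compactin_def)
  fix s x assume s: "range s \<subseteq> K" "conv s x"
  then obtain r y where "strict_mono r" "y \<in> K" "conv (s \<circ> r) y"
    using K unfolding seq_compactin_def by blast
  then show "x \<in> K" using limitin_subsequence[OF _ s(2)] conv_unique by blast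
qed

lemma seq_compactin_Un:
  assumes K: "seq_compactin X K" and L: "seq_compactin X L"
  shows "seq_compactin X (K \<union> L)"
  unfolding seq_compactin_def
proof (intro conjI allI impI)
  show "K \<union> L \<subseteq> topspace X" using K L by (simp add: seq_compactin_def)
  fix s :: "nat \<Rightarrow> 'a" assume s: "range s \<subseteq> K \<union> L"
  have main: "\<exists>r x. strict_mono r \<and> x \<in> K \<union> L \<and> conv (s \<circ> r) x"
    if M: "seq_compactin X M" "M \<subseteq> K \<union> L" "infinite {n. s n \<in> M}" for M
  proof -
    obtain r :: "nat \<Rightarrow> nat" where r: "strict_mono r" "\<And>n. s (r n) \<in> M"
      using infinite_enumerate[OF M(3)] by auto
    then obtain q x where "strict_mono q" "x \<in> M" "conv ((s \<circ> r) \<circ> q) x"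
      using M(1) unfolding seq_compactin_def by (metis comp_apply image_subset_iff)
    then show ?thesis
      using M(2) strict_mono_o[OF r(1), of q] by (metis comp_assoc subsetD)
  qed
  have "UNIV = {n. s n \<in> K} \<union> {n. s n \<in> L}" using s by auto
  then have "infinite {n. s n \<in> K} \<or> infinite {n. s n \<in> L}"
    by (metis finite_Un infinite_UNIV_nat)
  then show "\<exists>r x. strict_mono r \<and> x \<in> K \<union> L \<and> conv (s \<circ> r) x"
    using main[OF K] main[OF L] by auto
qed

lemma seq_compactin_binary_image:
  assumes h: "continuous_map (prod_topology X X) X (\<lambda>(x, y). h x y)"
    and K: "seq_compactin X K"
  shows "seq_compactin X ((\<lambda>(x, y). h x y) ` (K \<times> K))"
  unfolding seq_compactin_def
proof (intro conjI allI impI)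
  have "K \<times> K \<subseteq> topspace (prod_topology X X)" using K by (auto simp: seq_compactin_def)
  then show "(\<lambda>(x, y). h x y) ` (K \<times> K) \<subseteq> topspace X"
    using continuous_map_image_subset_topspace[OF h] by blast
  fix s :: "nat \<Rightarrow> 'a" assume "range s \<subseteq> (\<lambda>(x, y). h x y) ` (K \<times> K)"
  then have "s n \<in> (\<lambda>(x, y). h x y) ` (K \<times> K)" for n by blast
  then have "\<exists>p. p \<in> K \<times> K \<and> s n = h (fst p) (snd p)" for n by fastforce
  then obtain p where p: "\<And>n. p n \<in> K \<times> K" "\<And>n. s n = h (fst (p n)) (snd (p n))" by metis
  have "range (fst \<circ> p) \<subseteq> K" using p(1) by (auto simp: mem_Times_iff)
  then obtain r x where r: "strict_mono r" "x \<in> K" "conv (fst \<circ> p \<circ> r) x"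
    using K unfolding seq_compactin_def by blast
  have "range (snd \<circ> p \<circ> r) \<subseteq> K" using p(1) by (auto simp: mem_Times_iff)
  then obtain q y where q: "strict_mono q" "y \<in> K" "conv (snd \<circ> p \<circ> r \<circ> q) y"
    using K unfolding seq_compactin_def by blast
  have "conv (fst \<circ> p \<circ> r \<circ> q) x" by (rule limitin_subsequence[OF q(1) r(3)])
  from conv_binary[OF h this q(3)] have "conv (s \<circ> (r \<circ> q)) (h x y)"
    by (simp add: o_def p(2))
  moreover have "h x y \<in> (\<lambda>(x, y). h x y) ` (K \<times> K)" using r q by force
  ultimately show "\<exists>r x. strict_mono r \<and> x \<in> (\<lambda>(x, y). h x y) ` (K \<times> K) \<and> conv (s \<circ> r) x"
    using strict_mono_o[OF r(1) q(1)] by blast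
qed

text \<open>The union of the closures of all countable subsets of \<open>A\<close> is sequentially
  closed: the countably many sets behind the terms of a sequence have a countable union.\<close>

lemma countable_tightness:
  assumes "A \<subseteq> topspace X" "x \<in> X closure_of A"
  obtains D where "countable D" "D \<subseteq> A" "x \<in> X closure_of D"
proof -
  let ?B = "\<Union>{X closure_of D | D. countable D \<and> D \<subseteq> A}"
  have "closedin X ?B"
  proof (rule closedin_sequentially)
    show "?B \<subseteq> topspace X" using closure_of_subset_topspace by fastforce
    fix s y assume s: "range s \<subseteq> ?B" "conv s y"
    then have "\<forall>n. \<exists>D. countable D \<and> D \<subseteq> A \<and> s n \<in> X closure_of D" by blast
    then obtain D where D: "\<And>n. countable (D n) \<and> D n \<subseteq> A \<and> s n \<in> X closure_of D n" by metis
    have "X closure_of D n \<subseteq> X closure_of (\<Union>n. D n)" for n by (intro closure_of_mono) auto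
    then have "range s \<subseteq> X closure_of (\<Union>n. D n)" using D by blast
    then have "y \<in> X closure_of (\<Union>n. D n)" by (intro closedin_conv[OF _ s(2)]) auto
    moreover have "countable (\<Union>n. D n)" "(\<Union>n. D n) \<subseteq> A" using D by auto
    ultimately show "y \<in> ?B" by blast
  qed
  moreover have "A \<subseteq> ?B"
  proof
    fix a assume "a \<in> A"
    then have "a \<in> X closure_of {a}" "countable {a}" "{a} \<subseteq> A"
      using assms closure_of_subset[of "{a}" X] by auto
    then show "a \<in> ?B" by blast
  qed
  ultimately have "X closure_of A \<subseteq> ?B" by (rule closure_of_minimal[rotated])
  then show thesis using assms that by blast
qed

text \<open>The strong Frechet (countably bisequential) property at the single point
  \<open>e\<close>, for decreasing sequences of subsets of \<open>C\<close>.\<close>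

definition strongly_frechet :: "'a set \<Rightarrow> bool" where
  "strongly_frechet C \<longleftrightarrow>
     (\<forall>A. (\<forall>k::nat. A k \<subseteq> C \<and> A (Suc k) \<subseteq> A k \<and> e \<in> X closure_of A k) \<longrightarrow>
        (\<exists>s. (\<forall>k. s k \<in> A k) \<and> conv s e))"

lemma strongly_frechetE:
  assumes "strongly_frechet C"
    and "\<And>k::nat. A k \<subseteq> C" "\<And>k. A (Suc k) \<subseteq> A k" "\<And>k. e \<in> X closure_of A k"
  obtains s where "\<And>k. s k \<in> A k" "conv s e"
  using assms unfolding strongly_frechet_def by metis

end

text \<open>Stability under unions is what allows \<open>network\<close> to catch almost all terms,
  where a cs*-network catches infinitely many. Closedness makes intersections of members closed, as
  sequential compactness requires later.\<close>

locale lop_network = seq_lop +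
  fixes \<N> :: "'a set set"
  assumes countable_network: "countable \<N>"
    and network_closedin: "N \<in> \<N> \<Longrightarrow> closedin X N"
    and network_unit: "N \<in> \<N> \<Longrightarrow> e \<in> N"
    and network_Un: "\<lbrakk>N \<in> \<N>; N' \<in> \<N>\<rbrakk> \<Longrightarrow> N \<union> N' \<in> \<N>"
    and network: "\<lbrakk>openin X G; e \<in> G; limitin X s e sequentially\<rbrakk>
                    \<Longrightarrow> \<exists>N\<in>\<N>. N \<subseteq> G \<and> (\<forall>\<^sub>F n in sequentially. s n \<in> N)"

text \<open>Members are replaced by closures, which regularity keeps inside \<open>G\<close>, and
  then by finite unions. If no union \<open>F k\<close> of the first closures inside
  \<open>G\<close> held almost all terms, one could pick a subsequence whose \<open>k\<close>-th
  term avoids \<open>F k\<close>; yet one closure meets that subsequence infinitely often and lies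
  in all late \<open>F k\<close>.\<close>

lemma (in seq_lop) lop_network_exists:
  assumes "countable_cs_star_character X"
  shows "\<exists>\<N>. lop_network X mul e \<N>"
proof -
  obtain \<N>0 where N0: "countable \<N>0" "cs_star_network_at X e \<N>0"
    using assms unit_in unfolding countable_cs_star_character_def by blast
  define \<N>1 where "\<N>1 = (\<lambda>N. X closure_of N) ` {N \<in> \<N>0. e \<in> N}"
  define \<N> where "\<N> = {\<Union>\<F> | \<F>. finite \<F> \<and> \<F> \<subseteq> \<N>1 \<and> \<F> \<noteq> {}}"
  have sub: "N \<subseteq> topspace X" if "N \<in> \<N>0" for N
    using N0(2) that unfolding cs_star_network_at_def by blast
  have "countable \<N>1" using N0(1) by (auto simp: \<N>1_def)
  then have "countable {\<F>. finite \<F> \<and> \<F> \<subseteq> \<N>1}" by (rule countable_Collect_finite_subset)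
  then have "countable (Union ` {\<F>. finite \<F> \<and> \<F> \<subseteq> \<N>1})" by (rule countable_image)
  then have cN: "countable \<N>" by (rule countable_subset[rotated]) (auto simp: \<N>_def)
  have N1e: "e \<in> N" and N1c: "closedin X N" if N: "N \<in> \<N>1" for N
  proof -
    obtain M where "N = X closure_of M" "M \<in> \<N>0" "e \<in> M" using N by (auto simp: \<N>1_def)
    then show "e \<in> N" "closedin X N" using closure_of_subset[OF sub] by auto
  qed
  have net: "\<exists>N\<in>\<N>. N \<subseteq> G \<and> (\<forall>\<^sub>F n in sequentially. s n \<in> N)"
    if G: "openin X G" "e \<in> G" and s: "range s \<subseteq> topspace X" "conv s e" for G s
  proof -
    obtain V where V: "openin X V" "e \<in> V" "X closure_of V \<subseteq> G" using regularE G by metis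
    define \<E> where "\<E> = {N \<in> \<N>1. N \<subseteq> G}"
    have cE: "countable \<E>" using \<open>countable \<N>1\<close> by (simp add: \<E>_def)
    have E: "\<exists>N\<in>\<E>. infinite {n. t n \<in> N}" if t: "range t \<subseteq> topspace X" "conv t e" for t
    proof -
      obtain M where M: "M \<in> \<N>0" "e \<in> M" "M \<subseteq> V" "infinite {n. t n \<in> M}"
        using N0(2) V t unfolding cs_star_network_at_def by metis
      have "X closure_of M \<in> \<E>"
        using M V closure_of_mono[OF M(3), of X] by (auto simp: \<E>_def \<N>1_def)
      moreover have "{n. t n \<in> M} \<subseteq> {n. t n \<in> X closure_of M}"
        using closure_of_subset[OF sub[OF M(1)]] by blast
      ultimately show ?thesis using M(4) finite_subset by blast
    qed
    then have "\<E> \<noteq> {}" using s by blast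
    define F where "F = (\<lambda>k. \<Union>i\<le>k. from_nat_into \<E> i)"
    have F: "F k \<in> \<N>" "F k \<subseteq> G" for k
    proof -
      have "from_nat_into \<E> i \<in> \<E>" for i using \<open>\<E> \<noteq> {}\<close> by (rule from_nat_into)
      then have "from_nat_into \<E> ` {..k} \<subseteq> \<E>" by blast
      then show "F k \<in> \<N>" "F k \<subseteq> G" unfolding F_def \<N>_def \<E>_def
        by (auto intro!: exI[of _ "from_nat_into {N \<in> \<N>1. N \<subseteq> G} ` {..k}"])
    qed
    have "\<exists>k. \<forall>\<^sub>F n in sequentially. s n \<in> F k"
    proof (rule ccontr)
      assume "\<not> ?thesis"
      then have "\<exists>n>m. s n \<notin> F k" for k m
        unfolding eventually_sequentially by (metis less_eq_Suc_le)
      then have "\<exists>n>m. s n \<notin> F (Suc k)" "\<exists>n. s n \<notin> F 0" for k m by blast+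
      then have "\<exists>r. \<forall>k. s (r k) \<notin> F k \<and> r k < r (Suc k)"
        by (intro dependent_nat_choice) auto
      then obtain r where r: "\<And>k. s (r k) \<notin> F k" "strict_mono r"
        by (auto simp: strict_mono_Suc_iff)
      have "range (s \<circ> r) \<subseteq> topspace X" "conv (s \<circ> r) e"
        using s r limitin_subsequence by auto
      then obtain N where N: "N \<in> \<E>" "infinite {n. (s \<circ> r) n \<in> N}" using E by blast
      obtain i where i: "from_nat_into \<E> i = N"
        using from_nat_into_surj[OF cE N(1)] by blast
      obtain j where "j \<ge> i" "s (r j) \<in> N"
        using N(2) by (auto simp: infinite_nat_iff_unbounded_le)
      then have "s (r j) \<in> F j" using i by (auto simp: F_def)
      then show False using r by blast
    qed
    then show ?thesis using F by blast
  qed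
  have "lop_network X mul e \<N>"
  proof
    show "countable \<N>" by (rule cN)
    show "closedin X N" if "N \<in> \<N>" for N
      using that N1c by (auto simp: \<N>_def intro!: closedin_Union)
    show "e \<in> N" if "N \<in> \<N>" for N
      using that N1e by (auto simp: \<N>_def)
    show "N \<union> N' \<in> \<N>" if NN: "N \<in> \<N>" "N' \<in> \<N>" for N N'
    proof -
      obtain \<F> \<F>' where "N = \<Union>\<F>" "finite \<F>" "\<F> \<subseteq> \<N>1" "\<F> \<noteq> {}" "N' = \<Union>\<F>'" "finite \<F>'" "\<F>' \<subseteq> \<N>1"
        using NN by (auto simp: \<N>_def)
      then show ?thesis unfolding \<N>_def by (intro CollectI exI[of _ "\<F> \<union> \<F>'"]) auto
    qed
    show "\<exists>N\<in>\<N>. N \<subseteq> G \<and> (\<forall>\<^sub>F n in sequentially. s n \<in> N)"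
      if G: "openin X G" "e \<in> G" and s: "conv s e" for G s
    proof -
      \<comment> \<open>A cs*-network only speaks of sequences lying entirely in the space, so stray
        initial terms are reset to \<open>e\<close>.\<close>
      define t where "t = (\<lambda>n. if s n \<in> topspace X then s n else e)"
      have ev: "\<forall>\<^sub>F n in sequentially. s n = t n"
        using conv_in_eventually[OF s] by eventually_elim (simp add: t_def)
      have "range t \<subseteq> topspace X" by (auto simp: t_def)
      moreover have "conv t e" by (rule limitin_eq_eventually[OF s ev])
      ultimately obtain N where N: "N \<in> \<N>" "N \<subseteq> G" "\<forall>\<^sub>F n in sequentially. t n \<in> N"
        using net[OF G] by blast
      from N(3) ev have "\<forall>\<^sub>F n in sequentially. s n \<in> N" by eventually_elim simp
      with N show ?thesis by blast
    qed
  qed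
  then show ?thesis by blast
qed

section \<open>Metrizability from countable networks\<close>

context lop_network
begin

lemma network_nonempty:
  assumes "openin X G" "e \<in> G"
  shows "{N \<in> \<N>. N \<subseteq> G} \<noteq> {}"
  using network[OF assms, of "\<lambda>n. e"] by auto

text \<open>Otherwise the finite unions \<open>F k\<close>, again members of the network inside
  \<open>G\<close>, leave \<open>e\<close> in the closure of each \<open>C - F k\<close>. The strong
  Frechet property then gives a sequence avoiding \<open>F k\<close> at its \<open>k\<close>-th term
  and converging to \<open>e\<close>, which no member inside \<open>G\<close> can almost
  contain.\<close>

lemma strongly_frechet_neighbourhood:
  assumes C: "strongly_frechet C" "C \<subseteq> topspace X" and G: "openin X G" "e \<in> G"
  shows "\<exists>N\<in>\<N>. N \<subseteq> G \<and> (\<exists>W. openin X W \<and> e \<in> W \<and> W \<inter> C \<subseteq> N)"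
proof (rule ccontr)
  assume neg: "\<not> ?thesis"
  define \<E> where "\<E> = {N \<in> \<N>. N \<subseteq> G}"
  have E: "\<E> \<noteq> {}" "countable \<E>"
    using network_nonempty[OF G] countable_network by (auto simp: \<E>_def)
  define F where "F = (\<lambda>k. \<Union>i\<le>k. from_nat_into \<E> i)"
  have F: "F k \<in> \<E>" for k
  proof (induction k)
    case 0
    then show ?case using from_nat_into[OF E(1)] by (simp add: F_def)
  next
    case (Suc k)
    have "F (Suc k) = F k \<union> from_nat_into \<E> (Suc k)" by (auto simp: F_def atMost_Suc)
    then show ?case
      using Suc from_nat_into[OF E(1), of "Suc k"] network_Un by (auto simp: \<E>_def)
  qed
  have "F k \<subseteq> F (Suc k)" for k
    unfolding F_def by (intro UN_mono) auto
  then have "C - F k \<subseteq> C" "C - F (Suc k) \<subseteq> C - F k" for k by auto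
  moreover have "e \<in> X closure_of (C - F k)" for k
    unfolding in_closure_of
  proof (intro conjI allI impI)
    fix W assume W: "e \<in> W \<and> openin X W"
    have "F k \<in> \<N>" "F k \<subseteq> G" using F[of k] by (auto simp: \<E>_def)
    with neg W have "\<not> W \<inter> C \<subseteq> F k" by blast
    then show "\<exists>y. y \<in> C - F k \<and> y \<in> W" by blast
  qed simp
  ultimately obtain s where s: "\<And>k. s k \<in> C - F k" "conv s e"
    using strongly_frechetE[OF C(1), of "\<lambda>k. C - F k"] by metis
  obtain N where N: "N \<in> \<N>" "N \<subseteq> G" "\<forall>\<^sub>F n in sequentially. s n \<in> N"
    using network[OF G s(2)] by blast
  then have "N \<in> \<E>" by (simp add: \<E>_def)
  then obtain i where i: "from_nat_into \<E> i = N"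
    using from_nat_into_surj[OF E(2)] by blast
  obtain m where m: "\<And>n. n \<ge> m \<Longrightarrow> s n \<in> N"
    using N(3) by (auto simp: eventually_sequentially)
  have "s (max m i) \<in> F (max m i)"
    using m[of "max m i"] i by (auto simp: F_def intro!: bexI[of _ i])
  then show False using s(1) by blast
qed

text \<open>The sets \<open>B n\<close> shrink to \<open>e\<close> and contain neighbourhoods of
  \<open>e\<close> relative to \<open>C\<close>. As all quotients of points of \<open>K\<close> lie
  in \<open>C\<close>, the condition \<open>ldiv x y \<in> B n\<close> defines neighbourhoods of
  \<open>x\<close> in \<open>K\<close>.\<close>

theorem strongly_frechet_imp_metrizable:
  assumes C: "strongly_frechet C" "C \<subseteq> topspace X"
    and K: "K \<subseteq> topspace X" "\<And>x y. \<lbrakk>x \<in> K; y \<in> K\<rbrakk> \<Longrightarrow> ldiv x y \<in> C"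
  shows "metrizable_space (subtopology X K)"
proof -
  define \<B> where "\<B> = {N \<in> \<N>. \<exists>W. openin X W \<and> e \<in> W \<and> W \<inter> C \<subseteq> N}"
  have base_B: "\<exists>N\<in>\<B>. N \<subseteq> G" if "openin X G" "e \<in> G" for G
    using strongly_frechet_neighbourhood[OF C that] by (auto simp: \<B>_def)
  have B: "\<B> \<noteq> {}" "countable \<B>"
    using base_B[of "topspace X"] countable_network by (auto simp: \<B>_def)
  define B where "B = (\<lambda>n. \<Inter>i\<le>n. from_nat_into \<B> i)"
  have B_nbhd: "\<exists>W. openin X W \<and> e \<in> W \<and> W \<inter> C \<subseteq> B n" for n
  proof -
    have "\<exists>W. openin X W \<and> e \<in> W \<and> W \<inter> C \<subseteq> from_nat_into \<B> i" for i
      using from_nat_into[OF B(1), of i] by (auto simp: \<B>_def)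
    then obtain W where W: "\<And>i. openin X (W i)" "\<And>i. e \<in> W i" "\<And>i. W i \<inter> C \<subseteq> from_nat_into \<B> i"
      by metis
    have "openin X (\<Inter>i\<le>n. W i)" using W(1) by (intro openin_Inter) auto
    moreover have "e \<in> (\<Inter>i\<le>n. W i)" "(\<Inter>i\<le>n. W i) \<inter> C \<subseteq> B n"
      using W(2,3) by (auto simp: B_def)
    ultimately show ?thesis by blast
  qed
  have B_base: "\<exists>n. B n \<subseteq> G" if G: "openin X G" "e \<in> G" for G
  proof -
    obtain N where N: "N \<in> \<B>" "N \<subseteq> G" using base_B[OF G] by blast
    then obtain i where "from_nat_into \<B> i = N" using from_nat_into_surj[OF B(2)] by blast
    then have "B i \<subseteq> G" using N by (auto simp: B_def)
    then show ?thesis by blast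
  qed
  \<comment> \<open>Both quotients are required because \<open>ldiv y x\<close> is not determined by
    \<open>ldiv x y\<close>; symmetry is thus built in.\<close>
  define V where "V = (\<lambda>n x. {y \<in> K. ldiv x y \<in> B n \<and> ldiv y x \<in> B n})"
  have top: "topspace (subtopology X K) = K" using K(1) by auto
  have nbhd: "\<exists>G. openin X G \<and> x \<in> G \<and> G \<inter> K \<subseteq> V n x" if x: "x \<in> K" for n x
  proof -
    obtain W where W: "openin X W" "e \<in> W" "W \<inter> C \<subseteq> B n" using B_nbhd by blast
    have xX: "x \<in> topspace X" using x K by blast
    obtain P Q where PQ: "openin X P" "openin X Q" "x \<in> P" "x \<in> Q"
        "\<forall>v\<in>P. \<forall>w\<in>Q. ldiv v w \<in> W"
      using open_ldiv[OF W(1) xX xX] W(2) xX by (metis ldiv_self)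
    have "P \<inter> Q \<inter> K \<subseteq> V n x"
      using PQ W(3) K x unfolding V_def by blast
    moreover have "openin X (P \<inter> Q)" using PQ by auto
    ultimately show ?thesis using PQ by blast
  qed
  show ?thesis
  proof (rule metrizable_space_symmetric_neighbourhoods[where V = V, OF _ top])
    show "t1_space (subtopology X K)" using t1 by (rule t1_space_subtopology)
    show "V n x \<subseteq> K" for n x by (auto simp: V_def)
    show "\<exists>G. openin (subtopology X K) G \<and> x \<in> G \<and> G \<subseteq> V n x" if x: "x \<in> K" for n x
    proof -
      obtain G where G: "openin X G" "x \<in> G" "G \<inter> K \<subseteq> V n x" using nbhd[OF x] by blast
      have "openin (subtopology X K) (G \<inter> K)" using G(1) by (auto simp: openin_subtopology)
      then show ?thesis using G x by blast
    qed
    show "x \<in> V n y" if "x \<in> K" "y \<in> V n x" for n x y using that by (auto simp: V_def)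
    show "V (Suc n) x \<subseteq> V n x" for n x by (auto simp: V_def B_def)
    show "\<exists>n. V n x \<subseteq> G" if G: "openin (subtopology X K) G" "x \<in> G" for G x
    proof -
      obtain H where H: "openin X H" "G = H \<inter> K" using G(1) by (auto simp: openin_subtopology)
      have x: "x \<in> K" "x \<in> topspace X" and xH: "x \<in> H" using G H K by auto
      obtain P Q where PQ: "x \<in> P" "openin X Q" "e \<in> Q" "\<forall>v\<in>P. \<forall>w\<in>Q. mul v w \<in> H"
        using open_mul_unit[OF H(1) xH] by metis
      obtain n where n: "B n \<subseteq> Q" using B_base[OF PQ(2,3)] by blast
      have "y \<in> G" if "y \<in> V n x" for y
      proof -
        have "y \<in> K" "ldiv x y \<in> Q" using that n by (auto simp: V_def)
        then have "mul x (ldiv x y) \<in> H" using PQ by blast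
        then show ?thesis using \<open>y \<in> K\<close> x K H by auto
      qed
      then show ?thesis by blast
    qed
    show "\<exists>m. \<forall>y\<in>V m x. V m y \<subseteq> V n x" if x: "x \<in> K" for n x
    proof -
      obtain G where G: "openin X G" "x \<in> G" "G \<inter> K \<subseteq> V n x" using nbhd[OF x] by blast
      have xX: "x \<in> topspace X" using x K by blast
      \<comment> \<open>Continuity at \<open>(x, e)\<close> is used twice, from the outside in:
        \<open>y = mul x (ldiv x y)\<close> falls into \<open>P\<close>, then
        \<open>z = mul y (ldiv y z)\<close> falls into \<open>G\<close>. Choosing \<open>P\<close>
        first makes \<open>m\<close> independent of \<open>y\<close>, though not of
        \<open>x\<close>.\<close>
      obtain P Q where PQ: "openin X P" "x \<in> P" "openin X Q" "e \<in> Q"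
          "\<forall>v\<in>P. \<forall>w\<in>Q. mul v w \<in> G"
        using open_mul_unit[OF G(1,2)] by metis
      obtain P' Q' where PQ': "x \<in> P'" "openin X Q'" "e \<in> Q'"
          "\<forall>v\<in>P'. \<forall>w\<in>Q'. mul v w \<in> P"
        using open_mul_unit[OF PQ(1,2)] by metis
      have "openin X (Q \<inter> Q')" "e \<in> Q \<inter> Q'" using PQ PQ' by auto
      from B_base[OF this] obtain m where m: "B m \<subseteq> Q \<inter> Q'" by blast
      have "z \<in> V n x" if y: "y \<in> V m x" and z: "z \<in> V m y" for y z
      proof -
        have yK: "y \<in> K" "ldiv x y \<in> Q'" and zK: "z \<in> K" "ldiv y z \<in> Q"
          using y z m by (auto simp: V_def)
        have "mul x (ldiv x y) \<in> P" using PQ' yK by blast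
        then have "y \<in> P" using yK xX K by auto
        then have "mul y (ldiv y z) \<in> G" using PQ zK by blast
        then have "z \<in> G" using yK zK K by (metis mul_ldiv subsetD)
        then show ?thesis using G zK by blast
      qed
      then show ?thesis by blast
    qed
  qed
qed

section \<open>Countable networks on closures of countable sets\<close>

text \<open>Products are bracketed to the left, and the head of the list is the outermost right
  factor: without associativity the bracketing must be fixed, and multiplying by one more set on the
  right is \<open>Cons\<close>.\<close>

primrec network_products :: "'a \<Rightarrow> 'a set list \<Rightarrow> 'a set" where
  "network_products d [] = {d}"
| "network_products d (N # Ns) = (\<lambda>(x, y). mul x y) ` (network_products d Ns \<times> N)"

text \<open>
  If \<open>s\<close> converges to \<open>y\<close>, then \<open>y = s n \<cdot> (s n)\<inverse>y\<close> and \<open>(s n)\<inverse>y\<close> converges to the unit. So the points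
  at which the sets \<open>d N\<^sub>1 \<dots> N\<^sub>k\<close> form a network make up a sequentially closed set.
\<close>

lemma countable_network_closure:
  assumes D: "countable D" "D \<subseteq> topspace X"
  obtains \<P> where "countable \<P>"
    "\<And>y G. \<lbrakk>y \<in> X closure_of D; openin X G; y \<in> G\<rbrakk> \<Longrightarrow> \<exists>P\<in>\<P>. y \<in> P \<and> P \<subseteq> G"
proof -
  define \<P> where "\<P> = (\<lambda>(d, Ns). network_products d Ns) ` (D \<times> lists \<N>)"
  have "countable \<P>"
    unfolding \<P>_def
    by (rule countable_image[OF countable_SIGMA[OF D(1) countable_lists[OF countable_network]]])
  define Y where "Y = {y \<in> topspace X. \<forall>G. openin X G \<and> y \<in> G \<longrightarrow> (\<exists>P\<in>\<P>. y \<in> P \<and> P \<subseteq> G)}"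
  have "closedin X Y"
  proof (rule closedin_sequentially)
    show "Y \<subseteq> topspace X" by (auto simp: Y_def)
    fix s y assume s: "range s \<subseteq> Y" "conv s y"
    have y: "y \<in> topspace X" using s(2) by (rule limitin_topspace)
    have "\<exists>P\<in>\<P>. y \<in> P \<and> P \<subseteq> G" if G: "openin X G" "y \<in> G" for G
    proof -
      obtain V W where VW: "openin X V" "openin X W" "y \<in> V" "e \<in> W"
          "\<forall>v\<in>V. \<forall>w\<in>W. mul v w \<in> G"
        using open_mul_unit[OF G] by metis
      obtain N where N: "N \<in> \<N>" "N \<subseteq> W" "\<forall>\<^sub>F n in sequentially. ldiv (s n) y \<in> N"
        using network[OF VW(2,4) conv_ldiv_left[OF s(2)]] by blast
      have "\<forall>\<^sub>F n in sequentially. s n \<in> V" using s(2) VW by (auto simp: limitin_def)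
      with N(3) have "\<forall>\<^sub>F n in sequentially. ldiv (s n) y \<in> N \<and> s n \<in> V" by eventually_elim simp
      then obtain n where n: "ldiv (s n) y \<in> N" "s n \<in> V"
        using eventually_happens'[OF sequentially_bot] by blast
      have "s n \<in> Y" using s by blast
      then obtain P where P: "P \<in> \<P>" "s n \<in> P" "P \<subseteq> V"
        using n VW unfolding Y_def by blast
      let ?Q = "(\<lambda>(x, y). mul x y) ` (P \<times> N)"
      obtain d Ns where dN: "d \<in> D" "Ns \<in> lists \<N>" "P = network_products d Ns"
        using P(1) by (auto simp: \<P>_def)
      have "?Q = network_products d (N # Ns)" using dN by simp
      moreover have "(d, N # Ns) \<in> D \<times> lists \<N>" using dN N by auto
      ultimately have "?Q \<in> \<P>" unfolding \<P>_def by (metis (mono_tags) case_prod_conv image_eqI)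
      moreover have "y \<in> ?Q"
      proof -
        have "y = mul (s n) (ldiv (s n) y)" using \<open>s n \<in> Y\<close> y by (auto simp: Y_def)
        then show ?thesis using P n by force
      qed
      moreover have "?Q \<subseteq> G" using P N VW(5) by auto
      ultimately show ?thesis by (intro bexI[of _ ?Q] conjI)
    qed
    then show "y \<in> Y" using y by (simp add: Y_def)
  qed
  moreover have "D \<subseteq> Y"
  proof
    fix d assume "d \<in> D"
    have "network_products d [] \<in> \<P>" 
      unfolding \<P>_def using \<open>d \<in> D\<close> by (intro image_eqI[of _ _ "(d, [])"]) auto
    then show "d \<in> Y" using \<open>d \<in> D\<close> D by (auto simp: Y_def)
  qed
  ultimately have "X closure_of D \<subseteq> Y" by (rule closure_of_minimal[rotated])
  then show thesis using that[OF \<open>countable \<P>\<close>] unfolding Y_def by blast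
qed

text \<open>For \<open>y\<close> other than \<open>e\<close> some network set around
  \<open>y\<close> misses the closure of a neighbourhood of \<open>e\<close>; there are only
  countably many such sets to treat. Closures of \<open>G k\<close> occur because a limit of points
  of \<open>G k\<close> is known to lie only there.\<close>

lemma unit_G_delta_closure:
  assumes D: "countable D" "D \<subseteq> topspace X"
  obtains G :: "nat \<Rightarrow> 'a set" where "\<And>k. openin X (G k)" "\<And>k. e \<in> G k" "\<And>k. G (Suc k) \<subseteq> G k"
    "\<And>y. \<lbrakk>y \<in> X closure_of D; \<And>k. y \<in> X closure_of G k\<rbrakk> \<Longrightarrow> y = e"
proof -
  obtain \<P> where P: "countable \<P>"
      "\<And>y G. \<lbrakk>y \<in> X closure_of D; openin X G; y \<in> G\<rbrakk> \<Longrightarrow> \<exists>P\<in>\<P>. y \<in> P \<and> P \<subseteq> G"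
    using countable_network_closure[OF D] by blast
  \<comment> \<open>The empty set is inserted so that the family can be enumerated even if no
    \<open>P\<close> qualifies.\<close>
  define \<Q> where "\<Q> = insert {} {P \<in> \<P>. \<exists>W. openin X W \<and> e \<in> W \<and> P \<inter> X closure_of W = {}}"
  have Q: "\<Q> \<noteq> {}" "countable \<Q>" using P by (auto simp: \<Q>_def)
  have "\<exists>W. openin X W \<and> e \<in> W \<and> from_nat_into \<Q> i \<inter> X closure_of W = {}" for i
  proof (cases "from_nat_into \<Q> i = {}")
    case True
    then show ?thesis by (intro exI[of _ "topspace X"]) simp
  next
    case False
    moreover have "from_nat_into \<Q> i \<in> \<Q>" using Q(1) by (rule from_nat_into)
    ultimately show ?thesis unfolding \<Q>_def by blast
  qed
  then obtain W where W: "\<And>i. openin X (W i)" "\<And>i. e \<in> W i"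
      "\<And>i. from_nat_into \<Q> i \<inter> X closure_of W i = {}" by metis
  define G where "G = (\<lambda>k. \<Inter>i\<le>k. W i)"
  show thesis
  proof (rule that[of G])
    show "openin X (G k)" for k unfolding G_def using W(1) by (intro openin_Inter) auto
    show "e \<in> G k" "G (Suc k) \<subseteq> G k" for k using W(2) by (auto simp: G_def)
    show "y = e" if y: "y \<in> X closure_of D" "\<And>k. y \<in> X closure_of G k" for y
    proof (rule ccontr)
      assume "y \<noteq> e"
      have yX: "y \<in> topspace X" using y(1) closure_of_subset_topspace[of X D] by blast
      obtain U V where UV: "openin X U" "openin X V" "y \<in> U" "e \<in> V" "disjnt U V"
        using Hausdorff yX \<open>y \<noteq> e\<close> unit_in unfolding Hausdorff_space_def by metis
      then have UV': "U \<inter> X closure_of V = {}"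
        by (simp add: disjnt_def openin_Int_closure_of_eq_empty)
      obtain P' where P': "P' \<in> \<P>" "y \<in> P'" "P' \<subseteq> U" using P(2)[OF y(1) UV(1,3)] by blast
      have "P' \<inter> X closure_of V = {}" using UV' P' by blast
      then have "P' \<in> \<Q>" using P'(1) UV(2,4) unfolding \<Q>_def by blast
      then obtain i where i: "from_nat_into \<Q> i = P'" using from_nat_into_surj[OF Q(2)] by blast
      have "X closure_of G i \<subseteq> X closure_of W i" by (intro closure_of_mono) (auto simp: G_def)
      then show False using y(2)[of i] W(3)[of i] i P'(2) by auto
    qed
  qed
qed

text \<open>Tightness replaces each \<open>A k\<close> by a countable \<open>D k\<close>, and
  \<open>s k\<close> is taken in both \<open>D k\<close> and \<open>G k\<close>. Every convergent
  subsequence then tends to \<open>e\<close>, and sequential compactness lets no subsequence stay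
  outside a neighbourhood of \<open>e\<close>.\<close>

theorem seq_compactin_strongly_frechet:
  assumes C: "seq_compactin X C"
  shows "strongly_frechet C"
  unfolding strongly_frechet_def
proof (intro allI impI)
  fix A :: "nat \<Rightarrow> 'a set"
  assume A: "\<forall>k. A k \<subseteq> C \<and> A (Suc k) \<subseteq> A k \<and> e \<in> X closure_of A k"
  have CX: "C \<subseteq> topspace X" using C by (simp add: seq_compactin_def)
  have "\<exists>D. countable D \<and> D \<subseteq> A k \<and> e \<in> X closure_of D" for k
    using countable_tightness[of "A k" e] A CX by (metis subset_trans)
  then obtain D where D: "\<And>k. countable (D k)" "\<And>k. D k \<subseteq> A k" "\<And>k. e \<in> X closure_of D k" by metis
  have "countable (\<Union>k. D k)" "(\<Union>k. D k) \<subseteq> topspace X" using D A CX by blast+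
  then obtain G :: "nat \<Rightarrow> 'a set" where G: "\<And>k. openin X (G k)" "\<And>k. e \<in> G k" "\<And>k. G (Suc k) \<subseteq> G k"
      "\<And>y. \<lbrakk>y \<in> X closure_of (\<Union>k. D k); \<And>k. y \<in> X closure_of G k\<rbrakk> \<Longrightarrow> y = e"
    using unit_G_delta_closure by metis
  have G_mono: "G n \<subseteq> G m" if "m \<le> n" for m n
    using lift_Suc_antimono_le[of G, OF G(3) that] .
  have "\<exists>y. y \<in> D k \<and> y \<in> G k" for k using D(3)[of k] G by (auto simp: in_closure_of)
  then obtain s where s: "\<And>k. s k \<in> D k" "\<And>k. s k \<in> G k" by metis
  have "conv s e"
    unfolding limitin_def
  proof (intro conjI allI impI)
    fix W assume W: "openin X W \<and> e \<in> W"
    show "\<forall>\<^sub>F n in sequentially. s n \<in> W"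
    proof (rule ccontr)
      assume "\<not> ?thesis"
      then have "infinite {n. s n \<notin> W}"
        by (auto simp: eventually_sequentially infinite_nat_iff_unbounded_le)
      then obtain r :: "nat \<Rightarrow> nat" where r: "strict_mono r" "\<And>n. s (r n) \<notin> W"
        using infinite_enumerate by (metis (mono_tags, lifting) mem_Collect_eq)
      have sC: "s n \<in> C" for n using s(1)[of n] D(2)[of n] A by blast
      then have "range (s \<circ> r) \<subseteq> C" by auto
      then obtain q x where q: "strict_mono q" "x \<in> C" "conv (s \<circ> r \<circ> q) x"
        using C unfolding seq_compactin_def by blast
      have sX: "s n \<in> topspace X" for n using sC CX by blast
      have "x \<in> X closure_of (\<Union>k. D k)"
      proof (rule closedin_conv[OF _ q(3)])
        have "(\<Union>k. D k) \<subseteq> X closure_of (\<Union>k. D k)"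
          using \<open>(\<Union>k. D k) \<subseteq> topspace X\<close> by (rule closure_of_subset)
        then show "range (s \<circ> r \<circ> q) \<subseteq> X closure_of (\<Union>k. D k)" using s by auto
      qed simp
      moreover have "x \<in> X closure_of G k" for k
      proof (rule limitin_closedin[OF q(3)])
        have "s (r (q n)) \<in> X closure_of G k" if "n \<ge> k" for n
        proof -
          have "k \<le> r (q n)" using that seq_suble[OF r(1)] seq_suble[OF q(1)] le_trans by metis
          then have "s (r (q n)) \<in> G k" using s(2) G_mono by blast
          then show ?thesis using closure_of_subset[OF openin_subset[OF G(1)]] by blast
        qed
        then show "\<forall>\<^sub>F n in sequentially. (s \<circ> r \<circ> q) n \<in> X closure_of G k"
          by (auto simp: eventually_sequentially)
      qed auto
      ultimately have "x = e" by (rule G(4))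
      moreover have "x \<in> topspace X - W"
        by (rule closedin_conv[OF _ q(3)]) (use W r sX in auto)
      ultimately show False using W by blast
    qed
  qed simp
  then show "\<exists>s. (\<forall>k. s k \<in> A k) \<and> conv s e" using s D by blast
qed

end

section \<open>Diagonals and sequential compactness\<close>

text \<open>This settles one half of a recurring dichotomy: a sequence of indices either repeats a
  value infinitely often or has a strictly increasing subsequence.\<close>

lemma strict_mono_subseq_of_finite_to_one:
  fixes f :: "nat \<Rightarrow> nat"
  assumes "\<And>k. finite {j. f j = k}"
  obtains r :: "nat \<Rightarrow> nat" where "strict_mono r" "strict_mono (f \<circ> r)"
proof -
  have fin: "finite {j. f j \<le> k}" for k
  proof -
    have "{j. f j \<le> k} = (\<Union>i\<le>k. {j. f j = i})" by auto
    then show ?thesis using assms by auto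
  qed
  have ex: "\<exists>j'>j. f j' > f j" for j
  proof -
    have "infinite (UNIV - ({..j} \<union> {i. f i \<le> f j}))"
      using fin by (intro Diff_infinite_finite) auto
    then obtain j' where "j' \<notin> {..j} \<union> {i. f i \<le> f j}"
      by (metis Diff_iff finite.emptyI ex_in_conv)
    then show ?thesis by (intro exI[of _ j']) auto
  qed
  have "\<exists>r. \<forall>n. True \<and> (r n < r (Suc n) \<and> f (r n) < f (r (Suc n)))"
    using ex by (intro dependent_nat_choice) auto
  then obtain r where "\<And>n. r n < r (Suc n) \<and> f (r n) < f (r (Suc n))" by blast
  then show thesis by (intro that[of r]) (auto simp: strict_mono_Suc_iff)
qed

context seq_lop
begin

text \<open>Only the choice \<open>r\<close> of columns has to increase; the position
  \<open>q\<close> inside a column is free.\<close>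

definition diagonal_at_unit :: "(nat \<Rightarrow> nat \<Rightarrow> 'a) \<Rightarrow> bool" where
  "diagonal_at_unit x \<longleftrightarrow> (\<exists>r q. strict_mono r \<and> conv (\<lambda>j. x (r j) (q j)) e)"

text \<open>
  If \<open>a k n \<longlonglongrightarrow> s k\<close> for every \<open>k\<close> and \<open>s k \<longlonglongrightarrow> x\<close>, a diagonal of \<open>(s k)\<inverse> a k n\<close> converging to the unit
  gives a diagonal of \<open>a\<close> converging to \<open>x\<close>. So one step of sequential closure suffices.
\<close>

lemma frechet_of_diagonals:
  assumes diag: "\<And>x. (\<And>k. conv (x k) e) \<Longrightarrow> diagonal_at_unit x"
    and A: "A \<subseteq> topspace X" "y \<in> X closure_of A"
  obtains s where "range s \<subseteq> A" "conv s y"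
proof -
  define B where "B = {y. \<exists>s. range s \<subseteq> A \<and> conv s y}"
  have "closedin X B"
  proof (rule closedin_sequentially)
    show "B \<subseteq> topspace X" using limitin_topspace by (fastforce simp: B_def)
    fix s y assume s: "range s \<subseteq> B" "conv s y"
    then have "s k \<in> B" for k by blast
    then have "\<exists>a. range a \<subseteq> A \<and> conv a (s k)" for k by (simp add: B_def)
    then obtain a where a: "\<And>k. range (a k) \<subseteq> A" "\<And>k. conv (a k) (s k)" by metis
    define x where "x = (\<lambda>k n. ldiv (s k) (a k n))"
    have "conv (x k) e" for k unfolding x_def using a(2) by (rule conv_ldiv_right)
    then obtain r q where r: "strict_mono r" "conv (\<lambda>j. x (r j) (q j)) e"
      using diag[of x] by (auto simp: diagonal_at_unit_def)
    have "conv (\<lambda>j. mul ((s \<circ> r) j) (x (r j) (q j))) (mul y e)"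
      by (rule conv_mul[OF limitin_subsequence[OF r(1) s(2)] r(2)])
    moreover have "mul ((s \<circ> r) j) (x (r j) (q j)) = a (r j) (q j)" for j
    proof -
      have "s (r j) \<in> topspace X" using a(2) by (rule limitin_topspace)
      moreover have "a (r j) (q j) \<in> topspace X" using a(1)[of "r j"] A(1) by blast
      ultimately show ?thesis by (simp add: x_def)
    qed
    moreover have "y \<in> topspace X" using s(2) by (rule limitin_topspace)
    ultimately have "conv (\<lambda>j. a (r j) (q j)) y" by simp
    moreover have "range (\<lambda>j. a (r j) (q j)) \<subseteq> A" using a(1) by blast
    ultimately show "y \<in> B" unfolding B_def by blast
  qed
  moreover have "A \<subseteq> B"
  proof
    fix y assume y: "y \<in> A"
    then have "conv (\<lambda>n. y) y" using A(1) by auto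
    moreover have "range (\<lambda>n::nat. y) \<subseteq> A" using y by auto
    ultimately show "y \<in> B" unfolding B_def by blast
  qed
  ultimately have "X closure_of A \<subseteq> B" by (rule closure_of_minimal[rotated])
  then have "y \<in> B" using A(2) by blast
  then show thesis using that unfolding B_def by blast
qed

text \<open>A diagonal of sequences in \<open>A k\<close> converging to \<open>e\<close> suffices:
  \<open>r j \<ge> j\<close>, and the sets decrease.\<close>

lemma strongly_frechet_of_diagonals:
  assumes diag: "\<And>x. (\<And>k. conv (x k) e) \<Longrightarrow> diagonal_at_unit x"
  shows "strongly_frechet (topspace X)"
  unfolding strongly_frechet_def
proof (intro allI impI)
  fix A :: "nat \<Rightarrow> 'a set"
  assume A: "\<forall>k. A k \<subseteq> topspace X \<and> A (Suc k) \<subseteq> A k \<and> e \<in> X closure_of A k"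
  have "\<exists>s. range s \<subseteq> A k \<and> conv s e" for k
    using frechet_of_diagonals[OF diag, of "A k" e] A by metis
  then obtain x where x: "\<And>k. range (x k) \<subseteq> A k" "\<And>k. conv (x k) e" by metis
  then obtain r q where r: "strict_mono r" "conv (\<lambda>j. x (r j) (q j)) e"
    using diag[of x] by (auto simp: diagonal_at_unit_def)
  have "x (r j) (q j) \<in> A j" for j
  proof -
    have "A (r j) \<subseteq> A j"
      using lift_Suc_antimono_le[of A] A seq_suble[OF r(1), of j] by blast
    then show ?thesis using x(1)[of "r j"] by blast
  qed
  with r(2) show "\<exists>s. (\<forall>k. s k \<in> A k) \<and> conv s e"
    by (intro exI[of _ "\<lambda>j. x (r j) (q j)"]) blast
qed

text \<open>The values of \<open>y\<close> other than \<open>z\<close> form a sequentially closed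
  set: a convergent sequence of them either repeats a value infinitely often, which is then its
  limit, or has indices tending to infinity and yields a convergent subsequence of \<open>y\<close>.
  Regularity separates \<open>z\<close> from this set, and the value \<open>z\<close> itself is
  attained only finitely often.\<close>

lemma finite_accumulation:
  assumes y: "range y \<subseteq> topspace X" "\<not> has_convergent_subseq X y" and z: "z \<in> topspace X"
  obtains G where "openin X G" "z \<in> G" "finite {n. y n \<in> X closure_of G}"
proof -
  have fin: "finite {n. y n = w}" for w
  proof (rule ccontr)
    assume "infinite {n. y n = w}"
    then obtain r :: "nat \<Rightarrow> nat" where r: "strict_mono r" "\<And>n. y (r n) = w"
      using infinite_enumerate[of "{n. y n = w}"] by auto
    then have "y \<circ> r = (\<lambda>n. w)" by auto
    moreover have "w \<in> topspace X" using r(2)[of 0] y(1) by blast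
    ultimately have "conv (y \<circ> r) w" by simp
    then show False using y(2) r(1) by (auto simp: has_convergent_subseq_def)
  qed
  let ?A = "range y - {z}"
  have "closedin X ?A"
  proof (rule closedin_sequentially)
    show "?A \<subseteq> topspace X" using y(1) by blast
    fix s w assume s: "range s \<subseteq> ?A" "conv s w"
    then have "\<exists>n. s j = y n" for j by blast
    then obtain f where f: "\<And>j. s j = y (f j)" by metis
    show "w \<in> ?A"
    proof (cases "\<exists>k. infinite {j. f j = k}")
      case True
      then obtain k where "infinite {j. f j = k}" by blast
      then obtain r :: "nat \<Rightarrow> nat" where r: "strict_mono r" "\<And>j. f (r j) = k"
        using infinite_enumerate[of "{j. f j = k}"] by auto
      have "conv (s \<circ> r) w" by (rule limitin_subsequence[OF r(1) s(2)])
      moreover have "s \<circ> r = (\<lambda>n. y k)" using f r by auto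
      moreover have "conv (\<lambda>n. y k) (y k)" using y(1) by auto
      ultimately have "w = y k" using conv_unique by metis
      moreover have "s (r 0) = y k" using f r by simp
      ultimately show ?thesis using s(1) by (metis range_subsetD)
    next
      case False
      then have "finite {j. f j = k}" for k by blast
      then obtain r :: "nat \<Rightarrow> nat" where r: "strict_mono r" "strict_mono (f \<circ> r)"
        by (rule strict_mono_subseq_of_finite_to_one)
      have "conv (s \<circ> r) w" by (rule limitin_subsequence[OF r(1) s(2)])
      moreover have "s \<circ> r = y \<circ> (f \<circ> r)" using f by auto
      ultimately have False using y(2) r(2) by (auto simp: has_convergent_subseq_def)
      then show ?thesis ..
    qed
  qed
  then have "openin X (topspace X - ?A)" by auto
  moreover have "z \<in> topspace X - ?A" using z by simp
  ultimately obtain G where G: "openin X G" "z \<in> G" "X closure_of G \<subseteq> topspace X - ?A"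
    by (rule regularE)
  have "{n. y n \<in> X closure_of G} \<subseteq> {n. y n = z}" using G(3) by blast
  then have "finite {n. y n \<in> X closure_of G}" using fin finite_subset by blast
  with G show thesis using that by blast
qed

end

context lop_network
begin

text \<open>
  A discrete sequence in a separable (hence Lindelof) subspace can be perturbed without creating
  convergent subsequences. In a lop this replaces the missing continuous right division.
\<close>

lemma perturb_divergent:
  assumes y: "range y \<subseteq> topspace X" "\<not> has_convergent_subseq X y"
    and w: "\<And>n. conv (w n) (y n)" "\<And>n m. w n m \<in> D"
    and D: "countable D" "D \<subseteq> topspace X"
  obtains m where "\<And>n. n \<le> m n" "\<not> has_convergent_subseq X (\<lambda>n. w n (m n))"
proof -
  obtain \<P> where P: "countable \<P>"
      "\<And>y G. \<lbrakk>y \<in> X closure_of D; openin X G; y \<in> G\<rbrakk> \<Longrightarrow> \<exists>P\<in>\<P>. y \<in> P \<and> P \<subseteq> G"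
    using countable_network_closure[OF D] by blast
  define \<Q> where "\<Q> = insert {} {P \<in> \<P>. \<exists>G. openin X G \<and> P \<subseteq> G \<and> finite {n. y n \<in> X closure_of G}}"
  have Q: "\<Q> \<noteq> {}" "countable \<Q>" using P by (auto simp: \<Q>_def)
  have "\<exists>G. openin X G \<and> from_nat_into \<Q> i \<subseteq> G \<and> finite {n. y n \<in> X closure_of G}" for i
  proof (cases "from_nat_into \<Q> i = {}")
    case True
    then show ?thesis by (intro exI[of _ "{}"]) simp
  next
    case False
    moreover have "from_nat_into \<Q> i \<in> \<Q>" using Q(1) by (rule from_nat_into)
    ultimately show ?thesis unfolding \<Q>_def by blast
  qed
  then obtain G where G: "\<And>i. openin X (G i)" "\<And>i. from_nat_into \<Q> i \<subseteq> G i"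
      "\<And>i. finite {n. y n \<in> X closure_of G i}" by metis
  \<comment> \<open>If \<open>w n (m n)\<close> lies in \<open>H n\<close> and in \<open>G i\<close>
    with \<open>i \<le> n\<close>, then \<open>y n\<close> is in the closure of \<open>G i\<close>,
    which happens for finitely many \<open>n\<close> only. So the perturbed sequence cannot settle
    in any \<open>G i\<close>.\<close>
  define H where "H = (\<lambda>n. topspace X - (\<Union>i\<in>{i. i \<le> n \<and> y n \<notin> X closure_of G i}. X closure_of G i))"
  have H: "openin X (H n)" "y n \<in> H n" for n
  proof -
    have "closedin X (\<Union>i\<in>{i. i \<le> n \<and> y n \<notin> X closure_of G i}. X closure_of G i)"
      by (intro closedin_Union) auto
    then show "openin X (H n)" unfolding H_def by auto
    show "y n \<in> H n" using y(1) by (auto simp: H_def)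
  qed
  have "\<exists>m\<ge>n. w n m \<in> H n" for n
  proof -
    have "\<forall>\<^sub>F m in sequentially. w n m \<in> H n" using w(1)[of n] H by (auto simp: limitin_def)
    then obtain N where "\<forall>m\<ge>N. w n m \<in> H n" by (auto simp: eventually_sequentially)
    then show ?thesis by (intro exI[of _ "max n N"]) auto
  qed
  then obtain m where m: "\<And>n. n \<le> m n" "\<And>n. w n (m n) \<in> H n" by metis
  have "\<not> has_convergent_subseq X (\<lambda>n. w n (m n))"
  proof
    assume "has_convergent_subseq X (\<lambda>n. w n (m n))"
    then obtain r z where r: "strict_mono r" "conv ((\<lambda>n. w n (m n)) \<circ> r) z"
      by (auto simp: has_convergent_subseq_def)
    have zD: "z \<in> X closure_of D"
    proof (rule closedin_conv[OF _ r(2)])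
      show "range ((\<lambda>n. w n (m n)) \<circ> r) \<subseteq> X closure_of D"
        using w(2) closure_of_subset[OF D(2)] by auto
    qed simp
    have zX: "z \<in> topspace X" using r(2) by (rule limitin_topspace)
    obtain U where U: "openin X U" "z \<in> U" "finite {n. y n \<in> X closure_of U}"
      using finite_accumulation[OF y zX] by blast
    obtain P where P': "P \<in> \<P>" "z \<in> P" "P \<subseteq> U" using P(2)[OF zD U(1,2)] by blast
    then have "P \<in> \<Q>" unfolding \<Q>_def using U(1,3) by blast
    then obtain i where i: "from_nat_into \<Q> i = P" using from_nat_into_surj[OF Q(2)] by blast
    then have zG: "z \<in> G i" using G(2) P'(2) by blast
    have "\<forall>\<^sub>F j in sequentially. ((\<lambda>n. w n (m n)) \<circ> r) j \<in> G i"
      using r(2) G(1) zG by (auto simp: limitin_def)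
    then obtain J where J: "\<And>j. j \<ge> J \<Longrightarrow> w (r j) (m (r j)) \<in> G i"
      by (auto simp: eventually_sequentially)
    obtain M where M: "\<And>n. y n \<in> X closure_of G i \<Longrightarrow> n < M"
      using G(3)[of i] by (auto simp: finite_nat_set_iff_bounded)
    define j where "j = max J (max M i)"
    have rj: "j \<le> r j" by (rule seq_suble[OF r(1)])
    then have "y (r j) \<notin> X closure_of G i" using M[of "r j"] by (auto simp: j_def)
    moreover have "i \<le> r j" using rj by (simp add: j_def)
    moreover have "w (r j) (m (r j)) \<in> X closure_of G i"
      using J[of j] closure_of_subset[OF openin_subset[OF G(1)]] by (auto simp: j_def)
    ultimately show False using m(2)[of "r j"] by (auto simp: H_def)
  qed
  with m(1) show thesis using that by blast
qed

text \<open>A convergent sequence in \<open>A\<close> is treated by its column indices. If some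
  column occurs infinitely often, the limit is a repeated value, since \<open>a k\<close> has no
  convergent subsequence. If the columns escape, cancelling the left factors leaves a diagonal of
  \<open>x\<close> that the sets \<open>G k\<close> force to converge to \<open>e\<close>, which is
  excluded.\<close>

theorem seq_compactin_of_shrinking:
  fixes P :: "nat \<Rightarrow> 'a set"
  assumes P: "\<And>k. closedin X (P k)" "\<And>G. \<lbrakk>openin X G; e \<in> G\<rbrakk> \<Longrightarrow> \<exists>k0. \<forall>k\<ge>k0. P k \<subseteq> G"
    and x: "\<And>k. conv (x k) e" "\<not> diagonal_at_unit x"
  shows "\<exists>k. seq_compactin X (P k)"
proof (rule ccontr)
  assume neg: "\<not> ?thesis"
  have PX: "P k \<subseteq> topspace X" for k using P(1) by (rule closedin_subset)
  have "\<exists>y. range y \<subseteq> P k \<and> \<not> has_convergent_subseq X y" for k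
  proof -
    have "\<not> seq_compactin X (P k)" using neg by blast
    then obtain y where y: "range y \<subseteq> P k"
        "\<nexists>r z. strict_mono (r::nat\<Rightarrow>nat) \<and> z \<in> P k \<and> conv (y \<circ> r) z"
      using PX unfolding seq_compactin_def by metis
    have "\<not> has_convergent_subseq X y"
    proof
      assume "has_convergent_subseq X y"
      then obtain r z where r: "strict_mono r" "conv (y \<circ> r) z"
        by (auto simp: has_convergent_subseq_def)
      have "z \<in> P k" by (rule closedin_conv[OF P(1) r(2)]) (use y(1) in auto)
      then show False using y(2) r by blast
    qed
    then show ?thesis using y(1) by blast
  qed
  then obtain y where y: "\<And>k. range (y k) \<subseteq> P k" "\<And>k. \<not> has_convergent_subseq X (y k)" by metis
  have yX: "y k n \<in> topspace X" for k n using y(1)[of k] PX by blast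
  \<comment> \<open>\<open>conv (x k) e\<close> constrains only a tail of \<open>x k\<close>\<close>
  have "\<exists>N. \<forall>n\<ge>N. x k n \<in> topspace X" for k
    using conv_in_eventually[OF x(1)] by (auto simp: eventually_sequentially)
  then obtain N where N: "\<And>k n. n \<ge> N k \<Longrightarrow> x k n \<in> topspace X" by metis
  define x' where "x' = (\<lambda>k n. x k (n + N k))"
  have x'X: "x' k n \<in> topspace X" for k n using N by (simp add: x'_def)
  have x'_conv: "conv (x' k) e" for k unfolding x'_def using x(1) by (rule limitin_sequentially_offset)
  \<comment> \<open>\<open>D\<close> is fixed before the shifts \<open>M\<close> and the positions
    \<open>m\<close>, so it collects every point these choices may produce; being countable, it
    admits \<open>unit_G_delta_closure\<close> and \<open>perturb_divergent\<close>.\<close>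
  define D where "D = range (\<lambda>(k, n). x' k n) \<union> range (\<lambda>(k, n, l, i). mul (y k n) (x' l i))"
  have "countable D"
    unfolding D_def by (intro countable_Un countable_image countableI_type)
  moreover have "D \<subseteq> topspace X"
    unfolding D_def using yX x'X by auto
  ultimately have D: "countable D" "D \<subseteq> topspace X" by auto
  have x'D: "x' k n \<in> D" for k n
    unfolding D_def by (rule UnI1, rule range_eqI[of _ _ "(k, n)"]) simp
  have yx'D: "mul (y k n) (x' l i) \<in> D" for k n l i
    unfolding D_def by (rule UnI2, rule range_eqI[of _ _ "(k, n, l, i)"]) simp
  obtain G :: "nat \<Rightarrow> 'a set" where G: "\<And>k. openin X (G k)" "\<And>k. e \<in> G k" "\<And>k. G (Suc k) \<subseteq> G k"
      "\<And>z. \<lbrakk>z \<in> X closure_of D; \<And>k. z \<in> X closure_of G k\<rbrakk> \<Longrightarrow> z = e"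
    using unit_G_delta_closure[OF D] by metis
  have G_mono: "G n \<subseteq> G m" if "m \<le> n" for m n
    using lift_Suc_antimono_le[of G, OF G(3) that] .
  have "\<exists>M. \<forall>n\<ge>M. x' k n \<in> G k" for k
  proof -
    have "\<forall>\<^sub>F n in sequentially. x' k n \<in> G k" using x'_conv[of k] G(1,2) by (auto simp: limitin_def)
    then show ?thesis by (auto simp: eventually_sequentially)
  qed
  then obtain M where M: "\<And>k n. n \<ge> M k \<Longrightarrow> x' k n \<in> G k" by metis
  \<comment> \<open>The shift puts the whole \<open>k\<close>-th column into \<open>G k\<close>, so
    a limit along growing \<open>k\<close> lies in the closure of every \<open>G k\<close>.\<close>
  define u where "u = (\<lambda>k n. x' k (n + M k))"
  have u_conv: "conv (u k) e" for k unfolding u_def using x'_conv by (rule limitin_sequentially_offset)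
  have uG: "u k n \<in> G k" and uX: "u k n \<in> topspace X" and uD: "u k n \<in> D"
    and yuD: "mul (y k n) (u l i) \<in> D" for k n l i
    using M x'X x'D yx'D by (auto simp: u_def)
  have "\<exists>m. (\<forall>n. n \<le> m n) \<and> \<not> has_convergent_subseq X (\<lambda>n. mul (y k n) (u k (m n)))" for k
  proof -
    have "range (y k) \<subseteq> topspace X" using yX by auto
    moreover have "conv (\<lambda>i. mul (y k n) (u k i)) (y k n)" for n
      using conv_mul[OF _ u_conv, of "\<lambda>i. y k n" "y k n" k] yX[of k n] by simp
    ultimately show ?thesis
      using perturb_divergent[of "y k" "\<lambda>n i. mul (y k n) (u k i)" D] y(2)[of k] yuD D by metis
  qed
  then obtain m where m: "\<And>k n. n \<le> m k n"
      "\<And>k. \<not> has_convergent_subseq X (\<lambda>n. mul (y k n) (u k (m k n)))" by metis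
  define a where "a = (\<lambda>k n. mul (y k n) (u k (m k n)))"
  have aX: "a k n \<in> topspace X" for k n using yX uX by (simp add: a_def)
  have a_div: "\<not> has_convergent_subseq X (a k)" for k using m(2)[of k] by (simp add: a_def)
  define A where "A = {a k n | k n. a k n \<noteq> e}"
  have AX: "A \<subseteq> topspace X" using aX by (auto simp: A_def)
  have "closedin X A"
  proof (rule closedin_sequentially[OF AX])
    fix s z assume s: "range s \<subseteq> A" "conv s z"
    then have "\<exists>k n. s j = a k n \<and> a k n \<noteq> e" for j unfolding A_def by blast
    then obtain f g where fg: "\<And>j. s j = a (f j) (g j)" by metis
    show "z \<in> A"
    proof (cases "\<exists>k. infinite {j. f j = k}")
      case True
      then obtain k where "infinite {j. f j = k}" by blast
      then obtain r :: "nat \<Rightarrow> nat" where r: "strict_mono r" "\<And>j. f (r j) = k"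
        using infinite_enumerate[of "{j. f j = k}"] by auto
      have sr: "conv (s \<circ> r) z" by (rule limitin_subsequence[OF r(1) s(2)])
      show ?thesis
      proof (cases "\<exists>n. infinite {j. g (r j) = n}")
        case True
        then obtain n where "infinite {j. g (r j) = n}" by blast
        then obtain q :: "nat \<Rightarrow> nat" where q: "strict_mono q" "\<And>j. g (r (q j)) = n"
          using infinite_enumerate[of "{j. g (r j) = n}"] by auto
        have "conv (s \<circ> r \<circ> q) z" by (rule limitin_subsequence[OF q(1) sr])
        moreover have "s \<circ> r \<circ> q = (\<lambda>j. a k n)" using fg r q by auto
        moreover have "conv (\<lambda>j. a k n) (a k n)" using aX by auto
        ultimately have "z = a k n" using conv_unique by metis
        moreover have "s (r (q 0)) = a k n" using fg r q by simp
        ultimately show ?thesis using s(1) by (metis range_subsetD)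
      next
        case False
        then have "finite {j. (g \<circ> r) j = n}" for n by auto
        then obtain q :: "nat \<Rightarrow> nat" where q: "strict_mono q" "strict_mono ((g \<circ> r) \<circ> q)"
          by (rule strict_mono_subseq_of_finite_to_one)
        have "conv (s \<circ> r \<circ> q) z" by (rule limitin_subsequence[OF q(1) sr])
        moreover have "s \<circ> r \<circ> q = a k \<circ> (g \<circ> r \<circ> q)" using fg r by auto
        ultimately have False using a_div[of k] q(2) by (auto simp: has_convergent_subseq_def)
        then show ?thesis ..
      qed
    next
      case False
      then have "finite {j. f j = k}" for k by blast
      then obtain r :: "nat \<Rightarrow> nat" where r: "strict_mono r" "strict_mono (f \<circ> r)"
        by (rule strict_mono_subseq_of_finite_to_one)
      have sr: "conv (s \<circ> r) z" by (rule limitin_subsequence[OF r(1) s(2)])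
      let ?y = "\<lambda>j. y (f (r j)) (g (r j))"
      let ?u = "\<lambda>j. u (f (r j)) (m (f (r j)) (g (r j)))"
      have "conv ?y e"
        unfolding limitin_def
      proof (intro conjI allI impI)
        fix W assume W: "openin X W \<and> e \<in> W"
        then obtain k0 where k0: "\<And>k. k \<ge> k0 \<Longrightarrow> P k \<subseteq> W" using P(2) by blast
        have "?y j \<in> W" if "j \<ge> k0" for j
        proof -
          have "k0 \<le> f (r j)" using that seq_suble[OF r(2), of j] by simp
          then show ?thesis using k0 y(1)[of "f (r j)"] by blast
        qed
        then show "\<forall>\<^sub>F j in sequentially. ?y j \<in> W" by (auto simp: eventually_sequentially)
      qed simp
      \<comment> \<open>Since the left factors tend to \<open>e\<close>, division gives
        \<open>ldiv e z = z\<close> as the limit of the right factors alone.\<close>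
      from conv_ldiv[OF this sr] have "conv (\<lambda>j. ldiv (?y j) ((s \<circ> r) j)) (ldiv e z)" .
      moreover have "ldiv (?y j) ((s \<circ> r) j) = ?u j" for j
        using fg yX uX by (simp add: a_def)
      moreover have "z \<in> topspace X" using s(2) by (rule limitin_topspace)
      ultimately have uz: "conv ?u z" by simp
      have "z \<in> X closure_of D"
        by (rule closedin_conv[OF _ uz]) (use uD closure_of_subset[OF D(2)] in auto)
      moreover have "z \<in> X closure_of G k" for k
      proof (rule limitin_closedin[OF uz])
        have "?u j \<in> X closure_of G k" if "j \<ge> k" for j
        proof -
          have "k \<le> f (r j)" using that seq_suble[OF r(2), of j] by simp
          then have "?u j \<in> G k" using uG G_mono by blast
          then show ?thesis using closure_of_subset[OF openin_subset[OF G(1)]] by blast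
        qed
        then show "\<forall>\<^sub>F j in sequentially. ?u j \<in> X closure_of G k"
          by (auto simp: eventually_sequentially)
      qed auto
      ultimately have "z = e" by (rule G(4))
      with uz have "conv (\<lambda>j. x ((f \<circ> r) j) (m (f (r j)) (g (r j)) + M (f (r j)) + N (f (r j)))) e"
        by (simp add: u_def x'_def)
      then have "diagonal_at_unit x"
        unfolding diagonal_at_unit_def
        by (intro exI[of _ "f \<circ> r"] exI[of _ "\<lambda>j. m (f (r j)) (g (r j)) + M (f (r j)) + N (f (r j))"]
              conjI r(2))
      then show ?thesis using x(2) by contradiction
    qed
  qed
  moreover have "e \<in> X closure_of A"
    unfolding in_closure_of
  proof (intro conjI allI impI)
    fix W assume "e \<in> W \<and> openin X W"
    then have W: "openin X W" "e \<in> W" by auto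
    obtain V U where VU: "openin X V" "openin X U" "e \<in> V" "e \<in> U"
        "\<forall>v\<in>V. \<forall>w\<in>U. mul v w \<in> W" using open_mul_unit[OF W] by metis
    obtain k where k: "P k \<subseteq> V" using P(2)[OF VU(1,3)] by blast
    have "\<forall>\<^sub>F n in sequentially. u k n \<in> U" using u_conv[of k] VU by (auto simp: limitin_def)
    then obtain n0 where n0: "\<And>n. n \<ge> n0 \<Longrightarrow> u k n \<in> U" by (auto simp: eventually_sequentially)
    \<comment> \<open>Removing \<open>e\<close> from \<open>A\<close> leaves points of each column
      arbitrarily far out, because a column eventually equal to \<open>e\<close> would
      converge.\<close>
    have "\<exists>n\<ge>n0. a k n \<noteq> e"
    proof (rule ccontr)
      assume "\<not> ?thesis"
      then have "conv (a k) e"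
        by (intro limitin_eventually) (auto simp: eventually_sequentially)
      then have "conv (a k \<circ> id) e" by simp
      then show False using a_div[of k] strict_mono_id unfolding has_convergent_subseq_def by blast
    qed
    then obtain n where n: "n \<ge> n0" "a k n \<noteq> e" by blast
    have "y k n \<in> V" using y(1)[of k] k by blast
    moreover have "u k (m k n) \<in> U" using n0 m(1)[of n k] n(1) by simp
    ultimately have "a k n \<in> W" using VU(5) by (simp add: a_def)
    moreover have "a k n \<in> A" using n by (auto simp: A_def)
    ultimately show "\<exists>y. y \<in> A \<and> y \<in> W" by blast
  qed simp
  ultimately have "e \<in> A" by (simp add: closure_of_closedin)
  then show False by (auto simp: A_def)
qed

end

section \<open>The clopen sublop generated by sequentially compact intersections\<close>

context lop_network
begin

text \<open>
  The finite intersections of those members of the network that contain almost all \<open>s n\<close> shrink to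
  the unit, so one of them is sequentially compact.
\<close>

lemma seq_compactin_tail:
  assumes x: "\<And>k. conv (x k) e" "\<not> diagonal_at_unit x" and s: "conv s e"
  obtains \<F> where "finite \<F>" "\<F> \<subseteq> \<N>" "\<F> \<noteq> {}" "seq_compactin X (\<Inter>\<F>)"
    "\<forall>\<^sub>F n in sequentially. s n \<in> \<Inter>\<F>"
proof -
  define \<E> where "\<E> = {N \<in> \<N>. \<forall>\<^sub>F n in sequentially. s n \<in> N}"
  have net: "\<exists>N\<in>\<E>. N \<subseteq> G" if "openin X G" "e \<in> G" for G
    using network[OF that s] by (auto simp: \<E>_def)
  have E: "\<E> \<noteq> {}" "countable \<E>"
    using net[OF openin_topspace unit_in] countable_network by (auto simp: \<E>_def)
  define \<F> where "\<F> = (\<lambda>k. from_nat_into \<E> ` {..k::nat})"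
  have F: "finite (\<F> k)" "\<F> k \<subseteq> \<E>" "\<F> k \<noteq> {}" for k
    using from_nat_into[OF E(1)] by (auto simp: \<F>_def)
  have "\<exists>k. seq_compactin X (\<Inter>(\<F> k))"
  proof (rule seq_compactin_of_shrinking[OF _ _ x])
    show "closedin X (\<Inter>(\<F> k))" for k
      using F[of k] network_closedin by (intro closedin_Inter) (auto simp: \<E>_def)
    show "\<exists>k0. \<forall>k\<ge>k0. \<Inter>(\<F> k) \<subseteq> G" if G: "openin X G" "e \<in> G" for G
    proof -
      obtain N where N: "N \<in> \<E>" "N \<subseteq> G" using net[OF G] by blast
      obtain i where i: "from_nat_into \<E> i = N" using from_nat_into_surj[OF E(2) N(1)] by blast
      have "\<Inter>(\<F> k) \<subseteq> G" if "k \<ge> i" for k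
      proof -
        have "N \<in> \<F> k" using that i by (auto simp: \<F>_def)
        then show ?thesis using N(2) by blast
      qed
      then show ?thesis by blast
    qed
  qed
  then obtain k where k: "seq_compactin X (\<Inter>(\<F> k))" by blast
  have "\<forall>\<^sub>F n in sequentially. \<forall>N\<in>\<F> k. s n \<in> N"
    using F[of k] by (intro eventually_ball_finite) (auto simp: \<E>_def)
  then have "\<forall>\<^sub>F n in sequentially. s n \<in> \<Inter>(\<F> k)" by simp
  with F[of k] k show thesis by (intro that[of "\<F> k"]) (auto simp: \<E>_def)
qed

text \<open>Non-metrizability enters once, through a double sequence without a diagonal at
  \<open>e\<close>; that one witness serves for all sequences converging to
  \<open>e\<close>.\<close>

theorem clopen_sk_omega_sublop:
  assumes "\<not> metrizable_space X"
  shows "\<exists>U. sublop X mul U \<and> openin X U \<and> closedin X U \<and> sk_omega_space (subtopology X U)"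
proof -
  have "\<not> strongly_frechet (topspace X)"
  proof
    assume "strongly_frechet (topspace X)"
    then have "metrizable_space (subtopology X (topspace X))"
      by (rule strongly_frechet_imp_metrizable) auto
    then show False using assms by simp
  qed
  then have "\<exists>x. (\<forall>k. conv (x k) e) \<and> \<not> diagonal_at_unit x"
    using strongly_frechet_of_diagonals by blast
  then obtain x where x: "\<And>k. conv (x k) e" "\<not> diagonal_at_unit x" by blast
  define \<K> where "\<K> = {K. seq_compactin X K \<and> (\<exists>\<F>. finite \<F> \<and> \<F> \<subseteq> \<N> \<and> \<F> \<noteq> {} \<and> K = \<Inter>\<F>)}"
  have K_tail: "\<exists>K\<in>\<K>. \<forall>\<^sub>F n in sequentially. s n \<in> K" if s: "conv s e" for s
  proof -
    obtain \<F> where "finite \<F>" "\<F> \<subseteq> \<N>" "\<F> \<noteq> {}" "seq_compactin X (\<Inter>\<F>)"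
      "\<forall>\<^sub>F n in sequentially. s n \<in> \<Inter>\<F>"
      using seq_compactin_tail[OF x s] by metis
    then show ?thesis unfolding \<K>_def by blast
  qed
  have "countable (Inter ` {\<F>. finite \<F> \<and> \<F> \<subseteq> \<N>})"
    using countable_network by (intro countable_image countable_Collect_finite_subset)
  then have K_countable: "countable \<K>"
    by (rule countable_subset[rotated]) (auto simp: \<K>_def)
  have K_ne: "\<K> \<noteq> {}" using K_tail[of "\<lambda>n. e"] by auto
  have K_e: "e \<in> K" if "K \<in> \<K>" for K using that network_unit by (auto simp: \<K>_def)
  define K where "K = from_nat_into \<K>"
  have K: "K i \<in> \<K>" for i unfolding K_def using K_ne by (rule from_nat_into)
  have K_sc: "seq_compactin X (K i)" for i using K[of i] by (simp add: \<K>_def)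
  \<comment> \<open>Each stage adds one more set \<open>K (Suc n)\<close> together with all products
    and quotients of the previous stage, so the union is closed under both operations while every
    stage stays sequentially compact.\<close>
  define C where "C = rec_nat (K 0) (\<lambda>n C. (C \<union> K (Suc n)) \<union>
      ((\<lambda>(x, y). mul x y) ` (C \<times> C) \<union> (\<lambda>(x, y). ldiv x y) ` (C \<times> C)))"
  have C_0: "C 0 = K 0"
    and C_Suc: "C (Suc n) = (C n \<union> K (Suc n)) \<union>
      ((\<lambda>(x, y). mul x y) ` (C n \<times> C n) \<union> (\<lambda>(x, y). ldiv x y) ` (C n \<times> C n))" for n
    by (simp_all add: C_def)
  have C_sc: "seq_compactin X (C n)" for n
  proof (induction n)
    case 0
    then show ?case using K_sc by (simp add: C_0)
  next
    case (Suc n)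
    show ?case
      unfolding C_Suc
      by (intro seq_compactin_Un Suc K_sc seq_compactin_binary_image[OF continuous_mul]
            seq_compactin_binary_image[OF continuous_ldiv])
  qed
  have CX: "C n \<subseteq> topspace X" for n using C_sc[of n] by (simp add: seq_compactin_def)
  have C_dec: "C n \<subseteq> C (Suc n)" for n by (auto simp: C_Suc)
  have C_mono: "C m \<subseteq> C n" if "m \<le> n" for m n
    using lift_Suc_mono_le[of C, OF C_dec that] .
  have K_C: "K n \<subseteq> C n" for n by (cases n) (auto simp: C_0 C_Suc)
  have C_mul: "mul a b \<in> C (Suc n)" and C_ldiv: "ldiv a b \<in> C (Suc n)" if "a \<in> C n" "b \<in> C n" for a b n
    unfolding C_Suc using that by force+
  define U where "U = (\<Union>n. C n)"
  have UX: "U \<subseteq> topspace X" using CX by (auto simp: U_def)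
  have U_sub: "mul a b \<in> U \<and> ldiv a b \<in> U" if ab: "a \<in> U" "b \<in> U" for a b
  proof -
    obtain m n where "a \<in> C m" "b \<in> C n" using ab by (auto simp: U_def)
    then have "a \<in> C (max m n)" "b \<in> C (max m n)" using C_mono[of m "max m n"] C_mono[of n "max m n"] by auto
    from C_mul[OF this] C_ldiv[OF this] show ?thesis unfolding U_def by blast
  qed
  \<comment> \<open>Almost all quotients \<open>ldiv z (s j)\<close> lie in one \<open>K i\<close>;
    multiplying back by \<open>z\<close> costs one more stage. Both openness and the weak topology
    of \<open>U\<close> rest on this.\<close>
  have tail: "\<exists>n. \<forall>\<^sub>F j in sequentially. s j \<in> C n" if z: "z \<in> U" and s: "conv s z" for s z
  proof -
    have "conv (\<lambda>j. ldiv z (s j)) e" using s by (rule conv_ldiv_right)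
    then obtain K' where K': "K' \<in> \<K>" "\<forall>\<^sub>F j in sequentially. ldiv z (s j) \<in> K'"
      using K_tail[of "\<lambda>j. ldiv z (s j)"] by auto
    obtain i where i: "K i = K'"
      unfolding K_def using from_nat_into_surj[OF K_countable K'(1)] by blast
    obtain m where m: "z \<in> C m" using z by (auto simp: U_def)
    let ?n = "max m i"
    have zX: "z \<in> topspace X" using m CX by blast
    have zC: "z \<in> C ?n" using m C_mono[of m ?n] by auto
    have KC: "K' \<subseteq> C ?n" using K_C[of i] C_mono[of i ?n] i by auto
    have step: "mul z w \<in> C (Suc ?n)" if "w \<in> K'" for w
      by (rule C_mul[OF zC subsetD[OF KC that]])
    have "\<forall>\<^sub>F j in sequentially. s j \<in> C (Suc ?n)"
      using K'(2) conv_in_eventually[OF s]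
    proof eventually_elim
      case (elim j)
      then show ?case using step[of "ldiv z (s j)"] zX by simp
    qed
    then show ?thesis ..
  qed
  have U_open: "openin X U"
  proof -
    have "closedin X (topspace X - U)"
    proof (rule closedin_sequentially)
      fix s z assume s: "range s \<subseteq> topspace X - U" "conv s z"
      have "z \<notin> U"
      proof
        assume "z \<in> U"
        then obtain n where "\<forall>\<^sub>F j in sequentially. s j \<in> C n" using tail[OF _ s(2)] by blast
        then obtain j where "s j \<in> C n" using eventually_happens'[OF sequentially_bot] by blast
        then show False using s(1) by (auto simp: U_def)
      qed
      then show "z \<in> topspace X - U" using limitin_topspace[OF s(2)] by simp
    qed simp
    then show ?thesis using UX by (simp add: openin_closedin_eq)
  qed
  \<comment> \<open>As for open subgroups: \<open>ldiv (s j) z\<close> tends to \<open>e\<close> and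
    so enters the open set \<open>U\<close>, and multiplying by \<open>s j\<close> returns
    \<open>z\<close>.\<close>
  have U_closed: "closedin X U"
  proof (rule closedin_sequentially[OF UX])
    fix s z assume s: "range s \<subseteq> U" "conv s z"
    have "conv (\<lambda>j. ldiv (s j) z) e" using s(2) by (rule conv_ldiv_left)
    moreover have "e \<in> U" using K_e[OF K[of 0]] K_C[of 0] by (auto simp: U_def)
    ultimately have "\<forall>\<^sub>F j in sequentially. ldiv (s j) z \<in> U" using U_open by (simp add: limitin_def)
    then obtain j where j: "ldiv (s j) z \<in> U" using eventually_happens'[OF sequentially_bot] by blast
    have sj: "s j \<in> U" using s(1) by blast
    have "mul (s j) (ldiv (s j) z) = z" using sj UX limitin_topspace[OF s(2)] by auto
    then show "z \<in> U" using U_sub[OF sj j] by simp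
  qed
  \<comment> \<open>Quotients of \<open>C n\<close> lie in \<open>C (Suc n)\<close>, whose strong
    Frechet property makes \<open>C n\<close> metrizable.\<close>
  have C_metr: "metrizable_space (subtopology X (C n))" for n
    by (rule strongly_frechet_imp_metrizable[OF seq_compactin_strongly_frechet[OF C_sc[of "Suc n"]] CX CX C_ldiv])
  have C_compact: "compactin X (C n)" for n
  proof -
    obtain M d where M: "Metric_space M d" "subtopology X (C n) = Metric_space.mtopology M d"
      using C_metr[of n] unfolding metrizable_space_def by blast
    have top: "topspace (subtopology X (C n)) = C n" using CX[of n] by auto
    then have MC: "M = C n" using Metric_space.topspace_mtopology[OF M(1)] M(2) by simp
    have "compactin (Metric_space.mtopology M d) M"
      unfolding Metric_space.compactin_sequentially[OF M(1)]
    proof (intro conjI allI impI)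
      fix s :: "nat \<Rightarrow> 'a" assume s: "range s \<subseteq> M"
      then obtain r z where r: "strict_mono (r :: nat \<Rightarrow> nat)" "z \<in> C n" "conv (s \<circ> r) z"
        using C_sc[of n] MC unfolding seq_compactin_def by blast
      have "s j \<in> C n" for j using s MC by blast
      then have "limitin (subtopology X (C n)) (s \<circ> r) z sequentially"
        unfolding limitin_subtopology using r by simp
      then show "\<exists>l r. l \<in> M \<and> strict_mono r \<and> limitin (Metric_space.mtopology M d) (s \<circ> r) l sequentially"
        using r(1,2) MC M(2) by (intro exI[of _ z] exI[of _ r]) simp
    qed simp
    then have "compactin (subtopology X (C n)) (C n)" using M(2) MC by simp
    then show ?thesis by (simp add: compactin_subtopology)
  qed
  have "sk_omega_space (subtopology X U)"
    unfolding sk_omega_space_def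
  proof (intro exI[of _ "range C"] conjI ballI allI impI)
    show "countable (range C)" by simp
    show "\<Union>(range C) = topspace (subtopology X U)" using UX by (auto simp: U_def)
    have CU: "C n \<subseteq> U" for n by (auto simp: U_def)
    have sub: "subtopology (subtopology X U) (C n) = subtopology X (C n)" for n
      using CU[of n] by (simp add: subtopology_subtopology inf.absorb2)
    show "compactin (subtopology X U) L" if "L \<in> range C" for L
      using that C_compact CU by (auto simp: compactin_subtopology)
    show "metrizable_space (subtopology (subtopology X U) L)" if "L \<in> range C" for L
      using that C_metr sub by auto
    show "closedin (subtopology X U) A \<longleftrightarrow>
        (\<forall>L\<in>range C. closedin (subtopology (subtopology X U) L) (A \<inter> L))"
      if "A \<subseteq> topspace (subtopology X U)" for A
    proof
      assume "closedin (subtopology X U) A"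
      then show "\<forall>L\<in>range C. closedin (subtopology (subtopology X U) L) (A \<inter> L)"
        by (auto simp: closedin_subtopology)
    next
      assume A: "\<forall>L\<in>range C. closedin (subtopology (subtopology X U) L) (A \<inter> L)"
      have AU: "A \<subseteq> U" using that by auto
      have AC: "closedin X (A \<inter> C n)" for n
      proof -
        have "closedin (subtopology X (C n)) (A \<inter> C n)" using A by (metis sub rangeI)
        moreover have "closedin X (C n)" by (rule seq_compactin_closedin[OF C_sc])
        ultimately show ?thesis by (rule closedin_trans_full)
      qed
      \<comment> \<open>By \<open>tail\<close> a convergent sequence in \<open>A\<close> is almost
        contained in one \<open>C n\<close>, so closedness of the single trace
        \<open>A \<inter> C n\<close> captures its limit.\<close>
      have "closedin X A"
      proof (rule closedin_sequentially)
        show "A \<subseteq> topspace X" using AU UX by blast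
        fix s z assume s: "range s \<subseteq> A" "conv s z"
        have "z \<in> U" by (rule closedin_conv[OF U_closed s(2)]) (use s AU in auto)
        then obtain n where "\<forall>\<^sub>F j in sequentially. s j \<in> C n" using tail[OF _ s(2)] by blast
        then have "\<forall>\<^sub>F j in sequentially. s j \<in> A \<inter> C n"
          by (rule eventually_mono) (use s(1) in auto)
        then have "z \<in> A \<inter> C n" by (intro limitin_closedin[OF s(2) AC]) auto
        then show "z \<in> A" by blast
      qed
      then show "closedin (subtopology X U) A"
        using AU by (rule closedin_subset_topspace)
    qed
  qed
  moreover have "sublop X mul U"
    unfolding sublop_def
  proof (intro conjI)
    show "U \<noteq> {}" using K_e[OF K[of 0]] K_C[of 0] by (auto simp: U_def)
  qed (use UX U_sub in auto)
  ultimately show ?thesis using U_open U_closed by blast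
qed

end

theorem theorem7p1:
  fixes X :: "'a topology" and mul :: "'a \<Rightarrow> 'a \<Rightarrow> 'a"
  assumes "topological_lop X mul"
    and "regular_space X" and "t1_space X"
    and "\<not> metrizable_space X"
    and "sequential_space X"
    and "countable_cs_star_character X"
  shows "\<exists>U. sublop X mul U \<and> openin X U \<and> closedin X U \<and>
             sk_omega_space (subtopology X U)"
proof -
  obtain e where "e \<in> topspace X" "\<forall>x\<in>topspace X. mul x e = x \<and> mul e x = x"
    using assms(1) unfolding topological_lop_def by blast
  then have "seq_lop X mul e"
    using assms by (intro seq_lop.intro) auto
  from seq_lop.lop_network_exists[OF this assms(6)]
  obtain \<N> where "lop_network X mul e \<N>" by blast
  then show ?thesis
    using assms(4) by (rule lop_network.clopen_sk_omega_sublop)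
qed

end
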